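(* Let $r, k, n$ be integers with $0 \leq r \leq k \leq n$ and $k \geq 1$, and consider the set of monomials $$\mathcal{M}_{n,k}^{(r)} = \left\{ x_1^{c_1} x_2^{c_2} \cdots x_n^{c_n} \,:\, (c_1, \dots, c_n) = \mathtt{code}(\sigma) \text{ for some } \sigma \in \mathcal{OP}_{n,k}^{(r)} \right\}.$$ 1. The set $\mathcal{M}_{n,k}^{(r)}$ is the standard basis of the $\mathbb{Q}$-vector space $R_{n,k}^{(r)} = \mathbb{Q}[x_1,\dots,x_n]/I_{n,k}^{(r)}$ with respect to the $\mathtt{neglex}$ monomial order. 2. The set $\mathcal{M}_{n,k}^{(r)}$ is (descends to) a $\mathbb{Z}$-basis of the $\mathbb{Z}$-module $S_{n,k}^{(r)} = \mathbb{Z}[x_1,\dots,x_n]/J_{n,k}^{(r)}$.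
   Context: Ordered $r$-Stirling partitions: write $[n] = \{1,\dots,n\}$. $\mathcal{OP}_{n,k}^{(r)}$ is the set of ordered set partitions $\sigma = (B_1 \mid \cdots \mid B_k)$ of $[n]$ into $k$ nonempty blocks such that $1, 2, \dots, r$ lie in distinct blocks. Coinversion code: for $\sigma = (B_1 \mid \cdots \mid B_k) \in \mathcal{OP}_{n,k}^{(r)}$, $\mathtt{code}(\sigma) = (c_1, \dots, c_n)$ where, if $i \in B_j$, $$c_i = \begin{cases} |\{ \ell > j : \min(B_\ell) > i \}| & \text{if } i = \min(B_j), \\ |\{ \ell > j : \min(B_\ell) > i \}| + (j-1) & \text{if } i \neq \min(B_j). \end{cases}$$ Ideals: let $\mathbf{x}_m = (x_1,\dots,x_m)$, and let $e_d(\mathbf{x}_m)$ and $h_d(\mathbf{x}_m)$ be the elementary and complete homogeneous symmetric polynomials of degree $d$ in $x_1, \dots, x_m$. The ideal $I_{n,k}^{(r)} \subseteq \mathbb{Q}[x_1,\dots,x_n]$ is generated by $x_1^k, x_2^k, \dots, x_n^k$; by $e_n(\mathbf{x}_n), e_{n-1}(\mathbf{x}_n), \dots, e_{n-k+1}(\mathbf{x}_n)$; and by $h_{k-r+1}(\mathbf{x}_r), h_{k-r+2}(\mathbf{x}_r), \dots, h_k(\mathbf{x}_r)$ (no generators of this last kind when $r=0$). The ideal $J_{n,k}^{(r)} \subseteq \mathbb{Z}[x_1,\dots,x_n]$ has the same generating set. Monomial order: $\mathtt{neglex}$ is defined by $x_1^{a_1}\cdots x_n^{a_n} < x_1^{b_1}\cdots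 x_n^{b_n}$ if and only if there is $1 \leq i \leq n$ with $a_i < b_i$ and $a_{i+1} = b_{i+1}, \dots, a_n = b_n$. For an ideal $I \subseteq \mathbb{Q}[x_1,\dots,x_n]$, the standard basis of $\mathbb{Q}[x_1,\dots,x_n]/I$ with respect to a monomial order $<$ is the set of (images of) monomials $m$ such that for every nonzero $f \in I$ the leading monomial of $f$ does not divide $m$; it is a $\mathbb{Q}$-basis of the quotient. *)

theory Defs
  imports
    Complex_Main
    "HOL-Algebra.QuotRing"
    "HOL-Library.Disjoint_Sets"
    "HOL-Library.Poly_Mapping"
    "Jordan_Normal_Form.Missing_VectorSpace"
begin

section \<open>Ordered set partitions and their coinversion codes\<close>

text \<open>The list \<open>[B\<^sub>1, \<dots>, B\<^sub>k]\<close> stands for \<open>(B\<^sub>1 | \<dots> | B\<^sub>k)\<close>; the list index of \<open>B\<^sub>j\<close> is \<open>j - 1\<close>.\<close>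

definition ordered_partitions :: "nat \<Rightarrow> nat \<Rightarrow> nat \<Rightarrow> nat set list set" where
  "ordered_partitions n k r =
     {Bs. length Bs = k \<and> distinct Bs \<and> partition_on {1..n} (set Bs) \<and>
          (\<forall>a\<in>{1..r}. \<forall>b\<in>{1..r}. \<forall>B\<in>set Bs. a \<in> B \<longrightarrow> b \<in> B \<longrightarrow> a = b)}"

definition block_index :: "nat set list \<Rightarrow> nat \<Rightarrow> nat" where
  "block_index Bs i = (THE j. j < length Bs \<and> i \<in> Bs ! j)"

text \<open>Since \<open>block_index\<close> counts from 0, it is the summand \<open>j - 1\<close> of the usual formula.\<close>

definition coinv_code :: "nat set list \<Rightarrow> nat \<Rightarrow> nat" where
  "coinv_code Bs i =
     (let j = block_index Bs i;
          c = card {l. j < l \<and> l < length Bs \<and> i < Min (Bs ! l)}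
      in if i = Min (Bs ! j) then c else c + j)"


section \<open>Polynomials in finitely many variables\<close>

text \<open>
  A monomial is identified with its exponent vector, and \<open>poly_ring n\<close> is the ring of polynomials
  in \<open>x\<^sub>1, \<dots>, x\<^sub>n\<close>, a subring of the polynomials in the variables \<open>x\<^sub>i\<close> with \<open>i :: nat\<close>.
\<close>

type_synonym mono = "nat \<Rightarrow>\<^sub>0 nat"
type_synonym 'a mpoly = "mono \<Rightarrow>\<^sub>0 'a"

definition monomials :: "nat \<Rightarrow> mono set" where
  "monomials n = {m. Poly_Mapping.keys m \<subseteq> {1..n}}"

definition ring_on :: "'a::comm_ring_1 set \<Rightarrow> 'a ring" where
  "ring_on S = \<lparr>carrier = S, mult = (*), one = 1, zero = 0, add = (+)\<rparr>"

definition poly_ring :: "nat \<Rightarrow> 'a::comm_ring_1 mpoly ring" where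
  "poly_ring n = ring_on {p. Poly_Mapping.keys p \<subseteq> monomials n}"

definition mpoly_monom :: "mono \<Rightarrow> 'a::comm_ring_1 mpoly" where
  "mpoly_monom m = Poly_Mapping.single m 1"

definition mpoly_const :: "'a::comm_ring_1 \<Rightarrow> 'a mpoly" where
  "mpoly_const a = Poly_Mapping.single 0 a"

definition xvar :: "nat \<Rightarrow> 'a::comm_ring_1 mpoly" where
  "xvar i = mpoly_monom (Poly_Mapping.single i 1)"

definition esym :: "nat \<Rightarrow> nat \<Rightarrow> 'a::comm_ring_1 mpoly" where
  "esym m d = (\<Sum>S | S \<subseteq> {1..m} \<and> card S = d. \<Prod>i\<in>S. xvar i)"

text \<open>The sum of all monomials of degree \<open>d\<close> in \<open>x\<^sub>1, \<dots>, x\<^sub>m\<close>.\<close>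

definition hsym :: "nat \<Rightarrow> nat \<Rightarrow> 'a::comm_ring_1 mpoly" where
  "hsym m d = (\<Sum>a | a \<in> monomials m \<and> (\<Sum>i=1..m. Poly_Mapping.lookup a i) = d. mpoly_monom a)"


section \<open>The ideals and their quotients\<close>

definition stirling_gens :: "nat \<Rightarrow> nat \<Rightarrow> nat \<Rightarrow> 'a::comm_ring_1 mpoly set" where
  "stirling_gens n k r =
     (\<lambda>i. xvar i ^ k) ` {1..n} \<union> esym n ` {n - k + 1..n} \<union> hsym r ` {k - r + 1..k}"

definition stirling_ideal :: "nat \<Rightarrow> nat \<Rightarrow> nat \<Rightarrow> 'a::comm_ring_1 mpoly set" where
  "stirling_ideal n k r = Idl\<^bsub>poly_ring n\<^esub> (stirling_gens n k r)"

abbreviation ideal_I :: "nat \<Rightarrow> nat \<Rightarrow> nat \<Rightarrow> rat mpoly set" where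
  "ideal_I \<equiv> stirling_ideal"

abbreviation ideal_J :: "nat \<Rightarrow> nat \<Rightarrow> nat \<Rightarrow> int mpoly set" where
  "ideal_J \<equiv> stirling_ideal"

definition quot_module :: "nat \<Rightarrow> 'a::comm_ring_1 mpoly set \<Rightarrow> ('a, 'a mpoly set) module" where
  "quot_module n I = ring.extend (poly_ring n Quot I)
     \<lparr>smult = (\<lambda>a A. (I +>\<^bsub>poly_ring n\<^esub> mpoly_const a) \<otimes>\<^bsub>poly_ring n Quot I\<^esub> A)\<rparr>"

definition module_basis :: "('a, 'c) ring_scheme \<Rightarrow> ('a, 'b, 'd) module_scheme \<Rightarrow> 'b set \<Rightarrow> bool" where
  "module_basis R M B \<longleftrightarrow>
     B \<subseteq> carrier M \<and> \<not> module.lin_dep R M B \<and> module.span R M B = carrier M"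

text \<open>Distinct monomials of \<open>B\<close> are required to have distinct images in the quotient.\<close>

definition descends_to_basis :: "nat \<Rightarrow> 'a::comm_ring_1 mpoly set \<Rightarrow> mono set \<Rightarrow> bool" where
  "descends_to_basis n I B \<longleftrightarrow>
     B \<subseteq> monomials n \<and>
     inj_on (\<lambda>m. I +>\<^bsub>poly_ring n\<^esub> mpoly_monom m) B \<and>
     module_basis (ring_on UNIV) (quot_module n I) ((\<lambda>m. I +>\<^bsub>poly_ring n\<^esub> mpoly_monom m) ` B)"


section \<open>Standard monomials\<close>

definition neglex :: "nat \<Rightarrow> mono \<Rightarrow> mono \<Rightarrow> bool" where
  "neglex n a b \<longleftrightarrow>
     (\<exists>i\<in>{1..n}. Poly_Mapping.lookup a i < Poly_Mapping.lookup b i \<and>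
        (\<forall>j\<in>{i+1..n}. Poly_Mapping.lookup a j = Poly_Mapping.lookup b j))"

definition leading_mono :: "(mono \<Rightarrow> mono \<Rightarrow> bool) \<Rightarrow> 'a::comm_ring_1 mpoly \<Rightarrow> mono" where
  "leading_mono lt f =
     (THE m. m \<in> Poly_Mapping.keys f \<and> (\<forall>m'\<in>Poly_Mapping.keys f. m' \<noteq> m \<longrightarrow> lt m' m))"

text \<open>Multiplication of monomials is addition of exponent vectors.\<close>

definition mono_dvd :: "mono \<Rightarrow> mono \<Rightarrow> bool" where
  "mono_dvd a b \<longleftrightarrow> (\<exists>c. b = a + c)"

definition standard_monos ::
  "nat \<Rightarrow> (mono \<Rightarrow> mono \<Rightarrow> bool) \<Rightarrow> 'a::comm_ring_1 mpoly set \<Rightarrow> mono set" where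
  "standard_monos n lt I =
     {m \<in> monomials n. \<forall>f\<in>I. f \<noteq> 0 \<longrightarrow> \<not> mono_dvd (leading_mono lt f) m}"

definition code_monos :: "nat \<Rightarrow> nat \<Rightarrow> nat \<Rightarrow> mono set" where
  "code_monos n k r =
     {\<Sum>i=1..n. Poly_Mapping.single i (coinv_code Bs i) | Bs. Bs \<in> ordered_partitions n k r}"


section \<open>The structures are those intended\<close>

lemma monomials_add: "a \<in> monomials n \<Longrightarrow> b \<in> monomials n \<Longrightarrow> a + b \<in> monomials n"
  using Poly_Mapping.keys_add[of a b] by (auto simp: monomials_def)

lemma cring_ring_on:
  assumes "1 \<in> S" "\<And>x y. x \<in> S \<Longrightarrow> y \<in> S \<Longrightarrow> x * y \<in> S"
    "\<And>x y. x \<in> S \<Longrightarrow> y \<in> S \<Longrightarrow> x + y \<in> S" "\<And>x. x \<in> S \<Longrightarrow> - x \<in> S"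
  shows "cring (ring_on S)"
proof -
  have 0: "0 \<in> S" using assms(3)[OF assms(1) assms(4)[OF assms(1)]] by simp
  have inv: "\<exists>y\<in>S. x + y = 0" if "x \<in> S" for x using assms(4)[OF that] by (intro bexI[of _ "- x"]) auto
  show ?thesis
    by (intro cringI abelian_groupI comm_monoidI)
      (auto simp: ring_on_def assms 0 inv algebra_simps)
qed

lemma cring_scalars: "cring (ring_on UNIV)"
  by (rule cring_ring_on) auto

lemma cring_poly_ring: "cring (poly_ring n :: 'a::comm_ring_1 mpoly ring)"
  unfolding poly_ring_def
proof (rule cring_ring_on)
  show "1 \<in> {p :: 'a mpoly. Poly_Mapping.keys p \<subseteq> monomials n}"
    by (auto simp: monomials_def)
next
  fix p q :: "'a mpoly"
  assume p: "p \<in> {p. Poly_Mapping.keys p \<subseteq> monomials n}"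
    and q: "q \<in> {p. Poly_Mapping.keys p \<subseteq> monomials n}"
  show "p * q \<in> {p. Poly_Mapping.keys p \<subseteq> monomials n}"
    using p q Poly_Mapping.keys_mult[of p q] monomials_add by fastforce
  show "p + q \<in> {p. Poly_Mapping.keys p \<subseteq> monomials n}"
    using p q Poly_Mapping.keys_add[of p q] by auto
  show "- p \<in> {p. Poly_Mapping.keys p \<subseteq> monomials n}"
    using p by (simp add: Poly_Mapping.keys.rep_eq)
qed

lemma mpoly_const_closed: "mpoly_const a \<in> carrier (poly_ring n)"
  by (auto simp: mpoly_const_def poly_ring_def ring_on_def monomials_def)

lemma xvar_closed: "i \<in> {1..n} \<Longrightarrow> xvar i \<in> carrier (poly_ring n)"
  by (auto simp: xvar_def mpoly_monom_def poly_ring_def ring_on_def monomials_def)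

lemma stirling_gens_closed:
  assumes "r \<le> n"
  shows "stirling_gens n k r \<subseteq> carrier (poly_ring n :: 'a::comm_ring_1 mpoly ring)"
proof -
  interpret cring "poly_ring n :: 'a mpoly ring" by (rule cring_poly_ring)
  let ?C = "carrier (poly_ring n :: 'a mpoly ring)"
  have one: "1 \<in> ?C" and zero: "0 \<in> ?C"
    and mult: "\<And>p q. p \<in> ?C \<Longrightarrow> q \<in> ?C \<Longrightarrow> p * q \<in> ?C"
    and add: "\<And>p q. p \<in> ?C \<Longrightarrow> q \<in> ?C \<Longrightarrow> p + q \<in> ?C"
    using one_closed zero_closed m_closed a_closed by (simp_all add: poly_ring_def ring_on_def)
  have sum: "sum f A \<in> ?C" if "\<And>x. x \<in> A \<Longrightarrow> f x \<in> ?C" for f :: "'b \<Rightarrow> 'a mpoly" and A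
    using that by (induction A rule: infinite_finite_induct) (auto simp: zero add)
  have prod: "prod f A \<in> ?C" if "\<And>x. x \<in> A \<Longrightarrow> f x \<in> ?C" for f :: "'b \<Rightarrow> 'a mpoly" and A
    using that by (induction A rule: infinite_finite_induct) (auto simp: one mult)
  have "xvar i ^ k \<in> ?C" if "i \<in> {1..n}" for i
  proof -
    have x: "xvar i \<in> ?C" by (rule xvar_closed[OF that])
    show ?thesis by (induction k) (auto simp: one intro!: mult x)
  qed
  moreover have "esym n d \<in> ?C" for d
    unfolding esym_def by (intro sum prod xvar_closed) auto
  moreover have "hsym r d \<in> ?C" for d
    unfolding hsym_def
    using assms by (intro sum) (auto simp: mpoly_monom_def poly_ring_def ring_on_def monomials_def)
  ultimately show ?thesis unfolding stirling_gens_def by blast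
qed

lemma ideal_stirling_ideal:
  "r \<le> n \<Longrightarrow> ideal (stirling_ideal n k r) (poly_ring n)"
  unfolding stirling_ideal_def
  by (intro ring.genideal_ideal stirling_gens_closed cring.axioms(1) cring_poly_ring)

lemma finite_hsym_support:
  "finite {a. a \<in> monomials m \<and> (\<Sum>i=1..m. Poly_Mapping.lookup a i) = d}"
proof -
  let ?A = "{a. a \<in> monomials m \<and> (\<Sum>i=1..m. Poly_Mapping.lookup a i) = d}"
  have "Poly_Mapping.lookup ` ?A \<subseteq> {f. \<forall>i. (i \<in> {1..m} \<longrightarrow> f i \<in> {..d}) \<and> (i \<notin> {1..m} \<longrightarrow> f i = 0)}"
  proof clarify
    fix a i assume a: "a \<in> monomials m" and d: "d = (\<Sum>i=1..m. Poly_Mapping.lookup a i)"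
    have "Poly_Mapping.lookup a i \<le> (\<Sum>i=1..m. Poly_Mapping.lookup a i)" if "i \<in> {1..m}"
      using that by (intro member_le_sum) auto
    moreover have "Poly_Mapping.lookup a i = 0" if "i \<notin> {1..m}"
      using a that by (auto simp: monomials_def in_keys_iff)
    ultimately show "(i \<in> {1..m} \<longrightarrow> Poly_Mapping.lookup a i \<in> {..\<Sum>i=1..m. Poly_Mapping.lookup a i}) \<and>
        (i \<notin> {1..m} \<longrightarrow> Poly_Mapping.lookup a i = 0)" by auto
  qed
  hence "finite (Poly_Mapping.lookup ` ?A)"
    by (rule finite_subset) (intro finite_set_of_finite_funs, auto)
  thus ?thesis by (rule finite_imageD) (auto simp: inj_on_def poly_mapping_eqI)
qed

lemma module_quot_module:
  assumes "ideal I (poly_ring n :: 'a::comm_ring_1 mpoly ring)"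
  shows "module (ring_on UNIV) (quot_module n I)"
proof -
  interpret ideal I "poly_ring n :: 'a mpoly ring" by fact
  let ?P = "poly_ring n :: 'a mpoly ring"
  let ?Q = "?P Quot I"
  interpret Q: cring ?Q by (rule quotient_is_cring[OF cring_poly_ring])
  interpret \<phi>: ring_hom_ring ?P ?Q "(+>\<^bsub>?P\<^esub>) I" by (rule rcos_ring_hom_ring)
  have sel: "carrier (quot_module n I) = carrier ?Q" "add (quot_module n I) = add ?Q"
    "zero (quot_module n I) = zero ?Q" "mult (quot_module n I) = mult ?Q"
    "one (quot_module n I) = one ?Q"
    "smult (quot_module n I) = (\<lambda>a A. (I +>\<^bsub>?P\<^esub> mpoly_const a) \<otimes>\<^bsub>?Q\<^esub> A)"
    by (simp_all add: quot_module_def ring.defs)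
  note c = \<phi>.hom_closed[OF mpoly_const_closed]
  have ops: "\<And>p q :: 'a mpoly. p + q = p \<oplus>\<^bsub>?P\<^esub> q" "\<And>p q :: 'a mpoly. p * q = p \<otimes>\<^bsub>?P\<^esub> q"
    "\<one>\<^bsub>?P\<^esub> = mpoly_const 1"
    by (simp_all add: poly_ring_def ring_on_def mpoly_const_def)
  have ca: "mpoly_const (a + b) = (mpoly_const a \<oplus>\<^bsub>?P\<^esub> mpoly_const b)"
    and cm: "mpoly_const (a * b) = (mpoly_const a \<otimes>\<^bsub>?P\<^esub> mpoly_const b)" for a b :: 'a
    by (simp_all add: ops(1,2)[symmetric] mpoly_const_def single_add mult_single)
  show ?thesis
  proof (rule moduleI)
    show "cring (ring_on (UNIV :: 'a set))" by (rule cring_scalars)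
    show "abelian_group (quot_module n I)"
      by (rule abelian_groupI)
        (auto simp: sel Q.a_ac intro: bexI[where ?P = "\<lambda>y. y \<oplus>\<^bsub>?Q\<^esub> x = \<zero>\<^bsub>?Q\<^esub>" for x, OF Q.l_neg])
  next
    fix a b :: 'a and x y
    assume *: "x \<in> carrier (quot_module n I)" 
    hence x: "x \<in> carrier ?Q" by (simp add: sel)
    show "a \<odot>\<^bsub>quot_module n I\<^esub> x \<in> carrier (quot_module n I)"
      using x c by (simp add: sel)
    show "(a \<oplus>\<^bsub>ring_on UNIV\<^esub> b) \<odot>\<^bsub>quot_module n I\<^esub> x =
        a \<odot>\<^bsub>quot_module n I\<^esub> x \<oplus>\<^bsub>quot_module n I\<^esub> b \<odot>\<^bsub>quot_module n I\<^esub> x"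
      using x c by (simp add: sel ring_on_def ca mpoly_const_closed Q.l_distr)
    show "(a \<otimes>\<^bsub>ring_on UNIV\<^esub> b) \<odot>\<^bsub>quot_module n I\<^esub> x =
        a \<odot>\<^bsub>quot_module n I\<^esub> (b \<odot>\<^bsub>quot_module n I\<^esub> x)"
      using x c by (simp add: sel ring_on_def cm mpoly_const_closed Q.m_assoc)
    show "\<one>\<^bsub>ring_on UNIV\<^esub> \<odot>\<^bsub>quot_module n I\<^esub> x = x"
      using x \<phi>.hom_one by (simp add: sel ring_on_def ops)
    assume "y \<in> carrier (quot_module n I)" 
    thus "a \<odot>\<^bsub>quot_module n I\<^esub> (x \<oplus>\<^bsub>quot_module n I\<^esub> y) =
        a \<odot>\<^bsub>quot_module n I\<^esub> x \<oplus>\<^bsub>quot_module n I\<^esub> a \<odot>\<^bsub>quot_module n I\<^esub> y"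
      using x c by (simp add: sel Q.r_distr)
  qed
qed

end

theory Submission
  imports
    Defs
    "HOL-Computational_Algebra.Formal_Power_Series"
    "HOL-Library.Function_Algebras"
    "HOL-Library.Infinite_Set"
    "Jordan_Normal_Form.Determinant"
begin

text \<open>
  Inserting \<open>1, 2, \<dots>, n\<close> one after the other into \<open>k\<close> empty blocks, with \<open>E\<close> blocks still empty
  before the insertion of \<open>i\<close>, the letter \<open>c\<^sub>i\<close> of the code is less than \<open>E\<close> exactly if \<open>i\<close> opens
  a new block. So every word with \<open>c\<^sub>i < k\<close>, with \<open>c\<^sub>i \<le> k - i\<close> for \<open>i \<le> r\<close>, and with no empty block
  left at the end is a code. A monomial violating one of these conditions is divisible by the
  leading monomial of a monic element of the ideal: \<open>x\<^sub>i\<^sup>k\<close>, or \<open>h\<^sub>d(x\<^sub>1, \<dots>, x\<^sub>i)\<close> with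
  \<open>d = k - i + 1\<close>, or, for the positions \<open>s\<^sub>1 < \<dots> < s\<^sub>N\<close> with \<open>N = n - k + 1\<close> of the first letters
  that open no block, a flagged Schur determinant with entries \<open>h\<^sub>d(x\<^sub>1, \<dots>, x\<^bsub>s\<^sub>i\<^esub>)\<close>,
  \<open>d = k - s\<^sub>i + j\<close>. The latter lies in the ideal because
  \<open>(\<Prod>i\<le>n. 1 - x\<^sub>i t) / (\<Prod>i\<le>a. 1 - x\<^sub>i t)\<close> has degree \<open>n - a\<close>, which is a linear relation
  among the columns modulo the \<open>e\<^sub>d\<close> with \<open>d \<ge> N\<close>. Hence the code monomials span over any
  coefficient ring.

  For independence, ordered partitions are regarded as points of \<open>{0, \<dots>, k - 1}\<^sup>n\<close>. Each generator
  of the ideal agrees on these points with a polynomial of smaller degree. A linear relation among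
  the code monomials in the quotient would therefore make one of them redundant for spanning all
  functions on the points, although there are at most as many code monomials as points.
\<close>

section \<open>Polynomials in finitely many variables\<close>

definition mpolys :: "nat \<Rightarrow> 'a::comm_ring_1 mpoly set" where
  "mpolys n = {p. Poly_Mapping.keys p \<subseteq> monomials n}"

lemma poly_ring_simps [simp]:
  "carrier (poly_ring n) = mpolys n" "\<zero>\<^bsub>poly_ring n\<^esub> = 0" "\<one>\<^bsub>poly_ring n\<^esub> = 1"
  "p \<oplus>\<^bsub>poly_ring n\<^esub> q = p + q" "p \<otimes>\<^bsub>poly_ring n\<^esub> q = p * q"
  by (simp_all add: poly_ring_def ring_on_def mpolys_def)

lemma ring_on_simps [simp]:
  "carrier (ring_on S) = S" "\<zero>\<^bsub>ring_on S\<^esub> = 0" "\<one>\<^bsub>ring_on S\<^esub> = 1"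
  "p \<oplus>\<^bsub>ring_on S\<^esub> q = p + q" "p \<otimes>\<^bsub>ring_on S\<^esub> q = p * q"
  by (simp_all add: ring_on_def)

lemma mpolys_0 [simp]: "0 \<in> mpolys n"
  by (simp add: mpolys_def)

lemma mpolys_single [simp]: "m \<in> monomials n \<Longrightarrow> Poly_Mapping.single m c \<in> mpolys n"
  by (simp add: mpolys_def)

lemma mpolys_monom [simp]: "m \<in> monomials n \<Longrightarrow> mpoly_monom m \<in> mpolys n"
  by (simp add: mpoly_monom_def)

lemma monomials_0 [simp]: "0 \<in> monomials n"
  by (simp add: monomials_def)

lemma mpolys_1 [simp]: "1 \<in> mpolys n"
  by (simp add: mpolys_def)

lemma mpolys_add [simp]: "p \<in> mpolys n \<Longrightarrow> q \<in> mpolys n \<Longrightarrow> p + q \<in> mpolys n"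
  using Poly_Mapping.keys_add[of p q] by (auto simp: mpolys_def)

lemma mpolys_uminus [simp]: "p \<in> mpolys n \<Longrightarrow> - p \<in> mpolys n"
  by (simp add: mpolys_def Poly_Mapping.keys.rep_eq)

lemma mpolys_diff [simp]: "p \<in> mpolys n \<Longrightarrow> q \<in> mpolys n \<Longrightarrow> p - q \<in> mpolys n"
  using mpolys_add[of p n "- q"] by simp

lemma mpolys_mult [simp]: "p \<in> mpolys n \<Longrightarrow> q \<in> mpolys n \<Longrightarrow> p * q \<in> mpolys n"
  using Poly_Mapping.keys_mult[of p q] monomials_add by (fastforce simp: mpolys_def)

lemma mpolys_sum [simp]: "(\<And>x. x \<in> A \<Longrightarrow> f x \<in> mpolys n) \<Longrightarrow> sum f A \<in> mpolys n"
  by (induction A rule: infinite_finite_induct) auto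

lemma mpolys_prod [simp]: "(\<And>x. x \<in> A \<Longrightarrow> f x \<in> mpolys n) \<Longrightarrow> prod f A \<in> mpolys n"
  by (induction A rule: infinite_finite_induct) auto

lemma mpolys_power [simp]: "p \<in> mpolys n \<Longrightarrow> p ^ k \<in> mpolys n"
  by (induction k) auto

lemma monomials_mono: "m \<le> n \<Longrightarrow> monomials m \<subseteq> monomials n"
  by (auto simp: monomials_def)

lemma mpolys_mono: "m \<le> n \<Longrightarrow> p \<in> mpolys m \<Longrightarrow> p \<in> mpolys n"
  using monomials_mono by (auto simp: mpolys_def)

lemma monomials_single [simp]: "i \<in> {1..n} \<Longrightarrow> Poly_Mapping.single i e \<in> monomials n"
  by (simp add: monomials_def)

lemma mpolys_xvar [simp]: "i \<in> {1..n} \<Longrightarrow> xvar i \<in> mpolys n"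
  by (simp add: xvar_def)

lemma monomials_sum: "(\<And>x. x \<in> A \<Longrightarrow> f x \<in> monomials n) \<Longrightarrow> sum f A \<in> monomials n"
  by (induction A rule: infinite_finite_induct) (auto intro: monomials_add)

lemma lookup_notin_monomials: "m \<in> monomials n \<Longrightarrow> i \<notin> {1..n} \<Longrightarrow> Poly_Mapping.lookup m i = 0"
  by (auto simp: monomials_def in_keys_iff)

lemma poly_mapping_sum_single:
  "p = (\<Sum>m\<in>Poly_Mapping.keys p. Poly_Mapping.single m (Poly_Mapping.lookup p m))"
proof (rule poly_mapping_eqI)
  fix m
  have "(\<Sum>m'\<in>Poly_Mapping.keys p. Poly_Mapping.lookup (Poly_Mapping.single m' (Poly_Mapping.lookup p m')) m) =
    (\<Sum>m'\<in>Poly_Mapping.keys p. if m' = m then Poly_Mapping.lookup p m else 0)"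
    by (intro sum.cong) (auto simp: lookup_single)
  also have "\<dots> = Poly_Mapping.lookup p m" by (simp add: in_keys_iff)
  finally show "Poly_Mapping.lookup p m = Poly_Mapping.lookup
      (\<Sum>m\<in>Poly_Mapping.keys p. Poly_Mapping.single m (Poly_Mapping.lookup p m)) m"
    by (simp add: lookup_sum)
qed

lemma keys_sum_subset: "Poly_Mapping.keys (sum f A) \<subseteq> (\<Union>x\<in>A. Poly_Mapping.keys (f x))"
proof
  fix m assume "m \<in> Poly_Mapping.keys (sum f A)"
  hence "(\<Sum>x\<in>A. Poly_Mapping.lookup (f x) m) \<noteq> 0" by (simp add: in_keys_iff lookup_sum)
  then obtain x where "x \<in> A" "Poly_Mapping.lookup (f x) m \<noteq> 0"
    by (rule sum.not_neutral_contains_not_neutral)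
  thus "m \<in> (\<Union>x\<in>A. Poly_Mapping.keys (f x))" by (auto simp: in_keys_iff)
qed

lemma lookup_single_times:
  fixes p :: "'a::comm_ring_1 mpoly"
  shows "Poly_Mapping.lookup (Poly_Mapping.single c a * p) (c + m) = a * Poly_Mapping.lookup p m"
proof -
  have "Poly_Mapping.single c a * p =
      (\<Sum>m\<in>Poly_Mapping.keys p. Poly_Mapping.single (c + m) (a * Poly_Mapping.lookup p m))"
    using arg_cong[OF poly_mapping_sum_single[of p], of "(*) (Poly_Mapping.single c a)"]
    unfolding sum_distrib_left mult_single .
  also have "Poly_Mapping.lookup \<dots> (c + m) =
      (\<Sum>m'\<in>Poly_Mapping.keys p. if m' = m then a * Poly_Mapping.lookup p m else 0)"
    by (auto simp: lookup_sum lookup_single when_def intro!: sum.cong)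
  also have "\<dots> = a * Poly_Mapping.lookup p m" by (simp add: in_keys_iff)
  finally show ?thesis .
qed

lemma keys_single_times:
  "Poly_Mapping.keys (Poly_Mapping.single c a * (p :: 'a::comm_ring_1 mpoly)) \<subseteq> (+) c ` Poly_Mapping.keys p"
  using Poly_Mapping.keys_mult[of "Poly_Mapping.single c a" p] by (auto split: if_splits)

text \<open>The ideal laws in type class notation, which the simplifier handles better than the ring
  record. Negation is multiplication by the constant -1, and differences follow.\<close>

lemma ideal_closed:
  assumes "ideal J (poly_ring n :: 'a::comm_ring_1 mpoly ring)"
  shows "J \<subseteq> mpolys n" "0 \<in> J" "p \<in> J \<Longrightarrow> q \<in> J \<Longrightarrow> p + q \<in> J"
    "a \<in> mpolys n \<Longrightarrow> p \<in> J \<Longrightarrow> a * p \<in> J"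
    "p \<in> J \<Longrightarrow> - p \<in> J" "p \<in> J \<Longrightarrow> q \<in> J \<Longrightarrow> p - q \<in> J"
    "(\<And>x. x \<in> A \<Longrightarrow> f x \<in> J) \<Longrightarrow> sum f A \<in> J"
proof -
  interpret ideal J "poly_ring n :: 'a mpoly ring" by fact
  show 1: "J \<subseteq> mpolys n" and 2: "0 \<in> J" using a_subset additive_subgroup.zero_closed[OF is_additive_subgroup] by auto
  show 3: "p \<in> J \<Longrightarrow> q \<in> J \<Longrightarrow> p + q \<in> J" for p q using additive_subgroup.a_closed[OF is_additive_subgroup] by auto
  show 4: "a \<in> mpolys n \<Longrightarrow> p \<in> J \<Longrightarrow> a * p \<in> J" for a p using I_l_closed by auto
  show 5: "p \<in> J \<Longrightarrow> - p \<in> J" for p using 4[of "- 1" p] by simp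
  show "p \<in> J \<Longrightarrow> q \<in> J \<Longrightarrow> p - q \<in> J" using 3[of p "- q"] 5[of q] by simp
  show "(\<And>x. x \<in> A \<Longrightarrow> f x \<in> J) \<Longrightarrow> sum f A \<in> J"
    by (induction A rule: infinite_finite_induct) (auto simp: 2 3)
qed

text \<open>Meant for upper bounds on the Stirling ideal. Closure under negation, which an ideal
  also requires, comes from multiplying by the constant -1.\<close>

lemma genideal_least:
  fixes K :: "'a::comm_ring_1 mpoly set"
  assumes "S \<subseteq> K" "K \<subseteq> mpolys n" "0 \<in> K" "\<And>p q. p \<in> K \<Longrightarrow> q \<in> K \<Longrightarrow> p + q \<in> K"
    "\<And>a p. a \<in> mpolys n \<Longrightarrow> p \<in> K \<Longrightarrow> a * p \<in> K"
  shows "Idl\<^bsub>poly_ring n\<^esub> S \<subseteq> K"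
proof -
  interpret P: cring "poly_ring n :: 'a mpoly ring" by (rule cring_poly_ring)
  have neg: "- p \<in> K" if "p \<in> K" for p using assms(5)[of "- 1" p] that by simp
  have inv: "\<ominus>\<^bsub>poly_ring n\<^esub> p = - p" if "p \<in> K" for p
    using that assms(2) by (intro P.minus_equality) auto
  have "subgroup K (add_monoid (poly_ring n))"
    using assms neg inv by (intro P.add.subgroupI) (auto simp: a_inv_def[symmetric])
  moreover have "p * a \<in> K" if "a \<in> mpolys n" "p \<in> K" for a p
    using assms(5)[OF that] by (simp add: mult.commute)
  ultimately have "ideal K (poly_ring n)"
    using assms by (intro idealI) (auto intro: P.ring_axioms)
  thus ?thesis using P.genideal_minimal assms(1) by blast
qed

lemma stirling_gens_in_ideal: "r \<le> n \<Longrightarrow> stirling_gens n k r \<subseteq> stirling_ideal n k r"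
  unfolding stirling_ideal_def
  by (intro ring.genideal_self stirling_gens_closed cring.axioms(1) cring_poly_ring)


section \<open>Monomial bases of quotients and the neglex order\<close>

text \<open>A linear combination of monomials of \<open>B\<close> is a polynomial supported on
  \<open>B\<close>. This is linear independence modulo \<open>J\<close> counted with multiplicity:
  two monomials of \<open>B\<close> with equal images would have a nonzero difference in
  \<open>J\<close>.\<close>

definition mono_independent :: "'a::comm_ring_1 mpoly set \<Rightarrow> mono set \<Rightarrow> bool" where
  "mono_independent J B \<longleftrightarrow> (\<forall>p\<in>J. Poly_Mapping.keys p \<subseteq> B \<longrightarrow> p = 0)"

lemma single_minus_single_eq_0:
  assumes "Poly_Mapping.single m 1 - Poly_Mapping.single m' 1 = (0 :: 'a::comm_ring_1 mpoly)"
  shows "m = m'"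
proof (rule ccontr)
  assume "m \<noteq> m'"
  hence "Poly_Mapping.lookup (Poly_Mapping.single m 1 - Poly_Mapping.single m' 1 :: 'a mpoly) m = 1"
    by (simp add: lookup_minus lookup_single)
  thus False using assms by simp
qed

lemma lookup_sum_single:
  assumes "finite A"
  shows "Poly_Mapping.lookup (\<Sum>m\<in>A. Poly_Mapping.single m (f m)) m = (f m when m \<in> A)"
proof -
  have "(\<Sum>m'\<in>A. Poly_Mapping.lookup (Poly_Mapping.single m' (f m')) m) = (\<Sum>m'\<in>A. if m' = m then f m else 0)"
    by (intro sum.cong) (auto simp: lookup_single)
  thus ?thesis using assms by (simp add: lookup_sum when_def)
qed

text \<open>The remainders of the single monomials are added up with the coefficients of
  \<open>q\<close> as weights; the error is the same combination of elements of
  \<open>J\<close>.\<close>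

lemma reduce_linear:
  fixes J :: "'a::comm_ring_1 mpoly set"
  assumes J: "ideal J (poly_ring n)"
    and red: "\<And>m. m \<in> Poly_Mapping.keys q \<Longrightarrow> \<exists>p. Poly_Mapping.keys p \<subseteq> S \<and> mpoly_monom m - p \<in> J"
  shows "\<exists>p. Poly_Mapping.keys p \<subseteq> S \<and> q - p \<in> J"
proof -
  obtain \<rho> where \<rho>: "\<And>m. m \<in> Poly_Mapping.keys q \<Longrightarrow> Poly_Mapping.keys (\<rho> m) \<subseteq> S"
      "\<And>m. m \<in> Poly_Mapping.keys q \<Longrightarrow> mpoly_monom m - \<rho> m \<in> J"
    using red by metis
  define p where "p = (\<Sum>m\<in>Poly_Mapping.keys q. mpoly_const (Poly_Mapping.lookup q m) * \<rho> m)"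
  have "Poly_Mapping.keys p \<subseteq> S"
  proof
    fix x assume "x \<in> Poly_Mapping.keys p"
    then obtain m where m: "m \<in> Poly_Mapping.keys q"
      "x \<in> Poly_Mapping.keys (mpoly_const (Poly_Mapping.lookup q m) * \<rho> m)"
      unfolding p_def using keys_sum_subset by fastforce
    thus "x \<in> S" using \<rho>(1)[OF m(1)] keys_single_times[of 0 _ "\<rho> m"]
      unfolding mpoly_const_def by fastforce
  qed
  moreover have "q - p = (\<Sum>m\<in>Poly_Mapping.keys q. mpoly_const (Poly_Mapping.lookup q m) * (mpoly_monom m - \<rho> m))"
    using poly_mapping_sum_single[of q]
    by (simp add: p_def algebra_simps sum_subtractf mpoly_const_def mpoly_monom_def mult_single)
  moreover have "\<dots> \<in> J"
    using \<rho>(2) mpoly_const_closed by (intro ideal_closed(7)[OF J] ideal_closed(4)[OF J]) auto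
  ultimately show ?thesis by metis
qed

text \<open>A bridge from the module of cosets to polynomials. Under the projection
  \<open>\<phi>\<close>, a linear combination of cosets is the image of a polynomial supported on
  \<open>B\<close>, so span and independence can be checked on polynomials.\<close>

lemma descends_to_basisI:
  fixes J :: "'a::comm_ring_1 mpoly set"
  assumes J: "ideal J (poly_ring n)" and B: "B \<subseteq> monomials n"
    and span: "\<And>m. m \<in> monomials n \<Longrightarrow> \<exists>p. Poly_Mapping.keys p \<subseteq> B \<and> mpoly_monom m - p \<in> J"
    and indep: "mono_independent J B"
  shows "descends_to_basis n J B"
proof -
  let ?P = "poly_ring n :: 'a mpoly ring" and ?R = "ring_on (UNIV :: 'a set)" and ?M = "quot_module n J"
  let ?Q = "?P Quot J"
  define \<phi> where "\<phi> p = J +>\<^bsub>?P\<^esub> p" for p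
  interpret J: ideal J ?P by (rule J)
  interpret M: module ?R ?M by (rule module_quot_module[OF J])
  interpret \<phi>: ring_hom_ring ?P ?Q "(+>\<^bsub>?P\<^esub>) J" by (rule J.rcos_ring_hom_ring)
  have sel: "carrier ?M = carrier ?Q" "add ?M = add ?Q" "zero ?M = zero ?Q"
    "(\<odot>\<^bsub>?M\<^esub>) = (\<lambda>a A. \<phi> (mpoly_const a) \<otimes>\<^bsub>?Q\<^esub> A)"
    by (simp_all add: quot_module_def ring.defs \<phi>_def)
  have carr: "carrier ?M = \<phi> ` mpolys n"
    unfolding sel by (auto simp: FactRing_def A_RCOSETS_def' \<phi>_def)
  have \<phi>_closed: "\<phi> p \<in> carrier ?M" if "p \<in> mpolys n" for p
    using that carr by blast
  have \<phi>_add: "\<phi> (p + q) = \<phi> p \<oplus>\<^bsub>?M\<^esub> \<phi> q" if "p \<in> mpolys n" "q \<in> mpolys n" for p q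
    using that \<phi>.hom_add[of p q] by (simp add: sel \<phi>_def)
  have \<phi>_0: "\<phi> 0 = \<zero>\<^bsub>?M\<^esub>"
    using \<phi>.hom_zero by (simp add: sel \<phi>_def)
  have \<phi>_smult: "a \<odot>\<^bsub>?M\<^esub> \<phi> p = \<phi> (mpoly_const a * p)" if "p \<in> mpolys n" for a p
    using that mpoly_const_closed[of a n] \<phi>.hom_mult[of "mpoly_const a" p] by (simp add: sel \<phi>_def)
  have \<phi>_eq: "\<phi> p = \<phi> q \<longleftrightarrow> p - q \<in> J" if "p \<in> mpolys n" "q \<in> mpolys n" for p q
  proof -
    have "p \<ominus>\<^bsub>?P\<^esub> q = p - q"
    proof -
      have "\<ominus>\<^bsub>?P\<^esub> q = - q" using that by (intro J.minus_equality) auto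
      thus ?thesis by (simp add: a_minus_def)
    qed
    thus ?thesis
      using J.quotient_eq_iff_same_a_r_cos[OF J, of p q] that by (simp add: \<phi>_def)
  qed
  have \<phi>_J: "\<phi> p = \<zero>\<^bsub>?M\<^esub> \<longleftrightarrow> p \<in> J" if "p \<in> mpolys n" for p
    using \<phi>_eq[of p 0] that \<phi>_0 by simp
  have inj: "inj_on (\<lambda>m. \<phi> (mpoly_monom m)) B"
  proof (rule inj_onI)
    fix m m' assume m: "m \<in> B" "m' \<in> B" and eq: "\<phi> (mpoly_monom m) = \<phi> (mpoly_monom m')"
    let ?p = "mpoly_monom m - mpoly_monom m' :: 'a mpoly"
    have "m \<in> monomials n" "m' \<in> monomials n" using m B by auto
    hence "?p \<in> J" using \<phi>_eq[of "mpoly_monom m" "mpoly_monom m'"] eq by simp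
    moreover have "Poly_Mapping.keys ?p \<subseteq> B"
      using m Poly_Mapping.keys_diff[of "mpoly_monom m" "mpoly_monom m' :: 'a mpoly"]
      by (auto simp: mpoly_monom_def split: if_splits)
    ultimately have "?p = 0" using indep by (auto simp: mono_independent_def)
    thus "m = m'" unfolding mpoly_monom_def by (rule single_minus_single_eq_0)
  qed
  \<comment> \<open>Coefficients are indexed by cosets here, by monomials on the right. Injectivity
    on \<open>B\<close> keeps the coset of a new monomial apart from the earlier ones, so no summand
    is lost.\<close>
  have lincomb: "M.lincomb a ((\<lambda>m. \<phi> (mpoly_monom m)) ` A) =
      \<phi> (\<Sum>m\<in>A. Poly_Mapping.single m (a (\<phi> (mpoly_monom m))))" if "finite A" "A \<subseteq> B" for a A
    using that
  proof (induction A)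
    case empty
    thus ?case by (simp add: M.lincomb_def \<phi>_0)
  next
    case (insert m A)
    let ?f = "\<lambda>m. \<phi> (mpoly_monom m)" and ?g = "\<lambda>m. Poly_Mapping.single m (a (\<phi> (mpoly_monom m)))"
    have sub: "insert m A \<subseteq> monomials n" using insert.prems B by blast
    have img: "?f x \<in> carrier ?M" if "x \<in> insert m A" for x
      using that sub by (intro \<phi>_closed) auto
    have nin: "?f m \<notin> ?f ` A" using inj insert by (auto simp: inj_on_def)
    have "M.lincomb a (?f ` insert m A) = a (?f m) \<odot>\<^bsub>?M\<^esub> ?f m \<oplus>\<^bsub>?M\<^esub> M.lincomb a (?f ` A)"
      unfolding M.lincomb_def image_insert
      using nin insert.hyps img by (intro M.finsum_insert) (auto intro!: M.smult_closed)
    also have "a (?f m) \<odot>\<^bsub>?M\<^esub> ?f m = \<phi> (?g m)"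
      using sub by (simp add: \<phi>_smult mpoly_const_def mpoly_monom_def mult_single)
    also have "M.lincomb a (?f ` A) = \<phi> (\<Sum>m\<in>A. ?g m)" using insert by simp
    also have "\<phi> (?g m) \<oplus>\<^bsub>?M\<^esub> \<dots> = \<phi> (?g m + (\<Sum>m\<in>A. ?g m))"
      using sub by (intro \<phi>_add[symmetric] mpolys_sum mpolys_single) auto
    finally show ?case using insert.hyps by simp
  qed
  have "\<not> M.lin_dep ((\<lambda>m. \<phi> (mpoly_monom m)) ` B)"
  proof
    assume "M.lin_dep ((\<lambda>m. \<phi> (mpoly_monom m)) ` B)"
    then obtain A a v where A: "finite A" "A \<subseteq> (\<lambda>m. \<phi> (mpoly_monom m)) ` B"
      and 0: "M.lincomb a A = \<zero>\<^bsub>?M\<^esub>" and v: "v \<in> A" "a v \<noteq> 0"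
      unfolding M.lin_dep_def by auto
    obtain A' where A': "A' \<subseteq> B" "finite A'" "A = (\<lambda>m. \<phi> (mpoly_monom m)) ` A'"
      using A by (meson finite_subset_image)
    obtain m where m: "m \<in> A'" "v = \<phi> (mpoly_monom m)" using v A' by auto
    let ?p = "\<Sum>m\<in>A'. Poly_Mapping.single m (a (\<phi> (mpoly_monom m)))"
    have p: "?p \<in> mpolys n" using A' B by (intro mpolys_sum mpolys_single) auto
    have "?p \<in> J" using 0 lincomb[OF A'(2,1)] A'(3) \<phi>_J[OF p] by simp
    moreover have "Poly_Mapping.keys ?p \<subseteq> B"
      using A' by (auto simp: in_keys_iff lookup_sum_single when_def split: if_splits)
    ultimately have "?p = 0" using indep by (auto simp: mono_independent_def)
    hence "Poly_Mapping.lookup ?p m = 0" by simp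
    thus False using m v A' by (simp add: lookup_sum_single)
  qed
  moreover have "M.span ((\<lambda>m. \<phi> (mpoly_monom m)) ` B) = carrier ?M"
  proof
    show "M.span ((\<lambda>m. \<phi> (mpoly_monom m)) ` B) \<subseteq> carrier ?M"
    proof
      fix x assume "x \<in> M.span ((\<lambda>m. \<phi> (mpoly_monom m)) ` B)"
      then obtain a A where A: "finite A" "A \<subseteq> (\<lambda>m. \<phi> (mpoly_monom m)) ` B" "x = M.lincomb a A"
        unfolding M.span_def by auto
      then obtain A' where A': "A' \<subseteq> B" "finite A'" "A = (\<lambda>m. \<phi> (mpoly_monom m)) ` A'"
        by (meson finite_subset_image)
      show "x \<in> carrier ?M"
        unfolding A(3) A'(3) lincomb[OF A'(2,1)] using A' B
        by (intro \<phi>_closed mpolys_sum mpolys_single) auto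
    qed
    show "carrier ?M \<subseteq> M.span ((\<lambda>m. \<phi> (mpoly_monom m)) ` B)"
    proof
      fix x assume "x \<in> carrier ?M"
      then obtain q where q: "q \<in> mpolys n" "x = \<phi> q" unfolding carr by blast
      have "\<exists>p. Poly_Mapping.keys p \<subseteq> B \<and> q - p \<in> J"
      proof (rule reduce_linear[OF J])
        fix m assume "m \<in> Poly_Mapping.keys q"
        hence "m \<in> monomials n" using q by (auto simp: mpolys_def)
        thus "\<exists>p. Poly_Mapping.keys p \<subseteq> B \<and> mpoly_monom m - p \<in> J" by (rule span)
      qed
      then obtain p where keys_p: "Poly_Mapping.keys p \<subseteq> B" and "q - p \<in> J" by blast
      moreover have p: "p \<in> mpolys n" using keys_p B by (auto simp: mpolys_def)
      ultimately have "x = \<phi> p" using \<phi>_eq q by simp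
      also have "p = (\<Sum>m\<in>Poly_Mapping.keys p. Poly_Mapping.single m (Poly_Mapping.lookup p m))"
        by (rule poly_mapping_sum_single)
      \<comment> \<open>The coefficients of \<open>p\<close> become a function of cosets through the
        inverse of the map from \<open>B\<close> to its image; only then does \<open>lincomb\<close>
        apply.\<close>
      also have "\<dots> = (\<Sum>m\<in>Poly_Mapping.keys p. Poly_Mapping.single m
          (Poly_Mapping.lookup p (the_inv_into B (\<lambda>m. \<phi> (mpoly_monom m)) (\<phi> (mpoly_monom m)))))"
        using keys_p by (intro sum.cong refl) (auto simp: the_inv_into_f_f[OF inj])
      also have "\<phi> \<dots> = M.lincomb (\<lambda>v. Poly_Mapping.lookup p (the_inv_into B (\<lambda>m. \<phi> (mpoly_monom m)) v))
          ((\<lambda>m. \<phi> (mpoly_monom m)) ` Poly_Mapping.keys p)"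
        using keys_p by (intro lincomb[symmetric]) auto
      also have "\<dots> \<in> M.span ((\<lambda>m. \<phi> (mpoly_monom m)) ` B)"
        unfolding M.span_def by (intro CollectI exI conjI, rule refl) (use keys_p in auto)
      finally show "x \<in> M.span ((\<lambda>m. \<phi> (mpoly_monom m)) ` B)" .
    qed
  qed
  moreover have "(\<lambda>m. \<phi> (mpoly_monom m)) ` B \<subseteq> carrier ?M"
    using B by (auto intro!: \<phi>_closed)
  ultimately show ?thesis
    using inj B unfolding descends_to_basis_def module_basis_def \<phi>_def by blast
qed


section \<open>The neglex order and reduction by monic polynomials\<close>

lemma neglex_0 [simp]: "\<not> neglex 0 a b"
  by (simp add: neglex_def)

text \<open>The last variable decides first, so the order is an iterated lexicographic product.
  Transitivity, totality and well-foundedness follow by induction on the number of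
  variables.\<close>

lemma neglex_Suc:
  "neglex (Suc n) a b \<longleftrightarrow> Poly_Mapping.lookup a (Suc n) < Poly_Mapping.lookup b (Suc n) \<or>
     Poly_Mapping.lookup a (Suc n) = Poly_Mapping.lookup b (Suc n) \<and> neglex n a b"
  (is "?L \<longleftrightarrow> ?R")
proof
  assume ?L
  then obtain i where i: "i \<in> {1..Suc n}" "Poly_Mapping.lookup a i < Poly_Mapping.lookup b i"
    "\<forall>j\<in>{i+1..Suc n}. Poly_Mapping.lookup a j = Poly_Mapping.lookup b j"
    by (auto simp: neglex_def)
  thus ?R by (cases "i = Suc n") (auto simp: neglex_def intro!: bexI[of _ i])
next
  assume ?R
  thus ?L
  proof
    assume "Poly_Mapping.lookup a (Suc n) < Poly_Mapping.lookup b (Suc n)"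
    thus ?L unfolding neglex_def by (intro bexI[of _ "Suc n"]) auto
  next
    assume *: "Poly_Mapping.lookup a (Suc n) = Poly_Mapping.lookup b (Suc n) \<and> neglex n a b"
    then obtain i where i: "i \<in> {1..n}" "Poly_Mapping.lookup a i < Poly_Mapping.lookup b i"
      "\<forall>j\<in>{i+1..n}. Poly_Mapping.lookup a j = Poly_Mapping.lookup b j"
      by (auto simp: neglex_def)
    have "Poly_Mapping.lookup a j = Poly_Mapping.lookup b j" if "j \<in> {i+1..Suc n}" for j
      using i * that by (cases "j = Suc n") auto
    thus ?L unfolding neglex_def using i by (intro bexI[of _ i]) auto
  qed
qed

lemma neglex_irrefl [simp]: "\<not> neglex n a a"
  by (simp add: neglex_def)

lemma neglex_trans: "neglex n a b \<Longrightarrow> neglex n b c \<Longrightarrow> neglex n a c"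
  by (induction n) (auto simp: neglex_Suc)

lemma neglex_add: "neglex n a b \<Longrightarrow> neglex n (c + a) (c + b)"
  by (simp add: neglex_def lookup_add)

lemma neglex_total:
  assumes "a \<in> monomials n" "b \<in> monomials n" "a \<noteq> b"
  shows "neglex n a b \<or> neglex n b a"
proof (rule ccontr)
  assume *: "\<not> (neglex n a b \<or> neglex n b a)"
  have "Poly_Mapping.lookup a i = Poly_Mapping.lookup b i" if "i \<in> {1..n}" for i
    using * that by (induction n) (auto simp: neglex_Suc le_Suc_eq)
  hence "a = b" using assms by (intro poly_mapping_eqI) (metis lookup_notin_monomials)
  thus False using assms by simp
qed

lemma wf_neglex: "wf {(a, b). neglex n a b}"
proof (induction n)
  case (Suc n)
  have "{(a, b). neglex (Suc n) a b} = inv_image (less_than <*lex*> {(a, b). neglex n a b})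
      (\<lambda>a. (Poly_Mapping.lookup a (Suc n), a))"
    by (auto simp: neglex_Suc)
  thus ?case using Suc by (simp add: wf_inv_image wf_lex_prod)
qed simp

text \<open>Coefficient 1, not merely nonzero: then subtracting \<open>g\<close> eliminates the
  monomial \<open>m\<close> over every coefficient ring, the integers included.\<close>

definition monic_at :: "nat \<Rightarrow> mono \<Rightarrow> 'a::comm_ring_1 mpoly \<Rightarrow> bool" where
  "monic_at n m g \<longleftrightarrow> g \<in> mpolys n \<and> Poly_Mapping.lookup g m = 1 \<and>
     (\<forall>m'\<in>Poly_Mapping.keys g. m' \<noteq> m \<longrightarrow> neglex n m' m)"

lemma neglex_antisym: "neglex n a b \<Longrightarrow> \<not> neglex n b a"
  using neglex_trans neglex_irrefl by blast

lemma leading_mono_eqI: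
  assumes "m \<in> Poly_Mapping.keys f" "\<And>m'. m' \<in> Poly_Mapping.keys f \<Longrightarrow> m' \<noteq> m \<Longrightarrow> neglex n m' m"
  shows "leading_mono (neglex n) f = m"
  unfolding leading_mono_def
proof (rule the_equality)
  show "m \<in> Poly_Mapping.keys f \<and> (\<forall>m'\<in>Poly_Mapping.keys f. m' \<noteq> m \<longrightarrow> neglex n m' m)"
    using assms by blast
  fix x assume x: "x \<in> Poly_Mapping.keys f \<and> (\<forall>m'\<in>Poly_Mapping.keys f. m' \<noteq> x \<longrightarrow> neglex n m' x)"
  show "x = m"
  proof (rule ccontr)
    assume "x \<noteq> m"
    hence "neglex n x m" "neglex n m x" using assms x by auto
    thus False using neglex_antisym by blast
  qed
qed

lemma leading_mono_props:
  fixes f :: "'a::comm_ring_1 mpoly"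
  assumes "f \<in> mpolys n" "f \<noteq> 0"
  shows "leading_mono (neglex n) f \<in> Poly_Mapping.keys f"
    "\<And>m'. m' \<in> Poly_Mapping.keys f \<Longrightarrow> m' \<noteq> leading_mono (neglex n) f \<Longrightarrow>
      neglex n m' (leading_mono (neglex n) f)"
proof -
  have "\<exists>m\<in>S. \<forall>m'\<in>S. m' \<noteq> m \<longrightarrow> neglex n m' m" if "finite S" "S \<noteq> {}" "S \<subseteq> monomials n" for S
    using that
  proof (induction S rule: finite_ne_induct)
    case (insert x S)
    then obtain m where m: "m \<in> S" "\<forall>m'\<in>S. m' \<noteq> m \<longrightarrow> neglex n m' m" by auto
    have "neglex n x m \<or> neglex n m x" using insert m by (intro neglex_total) auto
    thus ?case
    proof
      assume "neglex n x m"
      thus ?case using m by (intro bexI[of _ m]) auto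
    next
      assume *: "neglex n m x"
      have "neglex n m' x" if "m' \<in> S" for m'
        using m(2) that * by (cases "m' = m") (auto intro: neglex_trans)
      thus ?case by (intro bexI[of _ x]) auto
    qed
  qed simp
  from this[of "Poly_Mapping.keys f"] assms
  obtain m where m: "m \<in> Poly_Mapping.keys f" "\<forall>m'\<in>Poly_Mapping.keys f. m' \<noteq> m \<longrightarrow> neglex n m' m"
    by (auto simp: mpolys_def)
  have "leading_mono (neglex n) f = m" using m by (intro leading_mono_eqI) auto
  thus "leading_mono (neglex n) f \<in> Poly_Mapping.keys f"
    "\<And>m'. m' \<in> Poly_Mapping.keys f \<Longrightarrow> m' \<noteq> leading_mono (neglex n) f \<Longrightarrow>
      neglex n m' (leading_mono (neglex n) f)"
    using m by auto
qed

lemma monic_at_leading_mono: "monic_at n m g \<Longrightarrow> leading_mono (neglex n) g = m"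
  by (intro leading_mono_eqI) (auto simp: monic_at_def in_keys_iff)

text \<open>Here \<open>b\<close> inverts the coefficient at \<open>m\<close>: it is 1 for a monic
  \<open>g\<close>, and the reciprocal of the leading coefficient over a field.\<close>

lemma monic_at_single_times:
  assumes "g \<in> mpolys n" "c \<in> monomials n" "b * Poly_Mapping.lookup g m = 1"
    "\<And>m'. m' \<in> Poly_Mapping.keys g \<Longrightarrow> m' \<noteq> m \<Longrightarrow> neglex n m' m"
  shows "monic_at n (c + m) (Poly_Mapping.single c b * g)"
  unfolding monic_at_def
proof (intro conjI ballI impI)
  show "Poly_Mapping.single c b * g \<in> mpolys n" using assms by simp
  show "Poly_Mapping.lookup (Poly_Mapping.single c b * g) (c + m) = 1"
    using assms by (simp add: lookup_single_times)
  fix m' assume m': "m' \<in> Poly_Mapping.keys (Poly_Mapping.single c b * g)" "m' \<noteq> c + m"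
  then obtain m'' where "m'' \<in> Poly_Mapping.keys g" "m' = c + m''"
    using keys_single_times[of c b g] by auto
  thus "neglex n m' (c + m)" using m' assms(4)[of m''] neglex_add by auto
qed

text \<open>Well-founded induction along \<open>neglex\<close>: for \<open>m\<close> outside
  \<open>B\<close>, subtracting the monic \<open>g\<close> leaves only smaller monomials, which
  reduce by induction. The bound on the support of \<open>p\<close> is what
  \<open>standard_monos_eqI\<close> needs to keep a reduced monomial from reappearing.\<close>

lemma monic_at_reduce:
  fixes J :: "'a::comm_ring_1 mpoly set"
  assumes J: "ideal J (poly_ring n)" and B: "B \<subseteq> monomials n"
    and red: "\<And>m. m \<in> monomials n \<Longrightarrow> m \<notin> B \<Longrightarrow> \<exists>g\<in>J. monic_at n m g"
    and m: "m \<in> monomials n"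
  shows "\<exists>p. Poly_Mapping.keys p \<subseteq> {m'\<in>B. m' = m \<or> neglex n m' m} \<and> mpoly_monom m - p \<in> J"
  using wf_neglex[of n] m
proof (induction m rule: wf_induct_rule)
  case (less m)
  show ?case
  proof (cases "m \<in> B")
    case True
    thus ?thesis
      by (intro exI[of _ "mpoly_monom m"]) (auto simp: mpoly_monom_def ideal_closed(2)[OF J])
  next
    case False
    then obtain g where g: "g \<in> J" "monic_at n m g" using red less.prems by blast
    let ?q = "mpoly_monom m - g"
    have q: "m' \<in> monomials n \<and> neglex n m' m" if "m' \<in> Poly_Mapping.keys ?q" for m'
    proof -
      have "m' \<noteq> m" using g that by (auto simp: in_keys_iff mpoly_monom_def lookup_minus monic_at_def)
      hence "m' \<in> Poly_Mapping.keys g"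
        using that by (auto simp: in_keys_iff mpoly_monom_def lookup_minus lookup_single)
      thus ?thesis using g \<open>m' \<noteq> m\<close> by (auto simp: monic_at_def mpolys_def)
    qed
    have "\<exists>p. Poly_Mapping.keys p \<subseteq> {m'\<in>B. m' = m \<or> neglex n m' m} \<and> ?q - p \<in> J"
    proof (rule reduce_linear[OF J])
      fix m' assume "m' \<in> Poly_Mapping.keys ?q"
      hence m': "m' \<in> monomials n" "neglex n m' m" using q by auto
      then obtain p where p: "Poly_Mapping.keys p \<subseteq> {m''\<in>B. m'' = m' \<or> neglex n m'' m'}"
        "mpoly_monom m' - p \<in> J" using less.IH[of m'] by auto
      have "Poly_Mapping.keys p \<subseteq> {m''\<in>B. m'' = m \<or> neglex n m'' m}"
        using p(1) m'(2) neglex_trans by blast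
      thus "\<exists>p. Poly_Mapping.keys p \<subseteq> {m'\<in>B. m' = m \<or> neglex n m' m} \<and> mpoly_monom m' - p \<in> J"
        using p(2) by blast
    qed
    then obtain p where p: "Poly_Mapping.keys p \<subseteq> {m'\<in>B. m' = m \<or> neglex n m' m}" "?q - p \<in> J"
      by blast
    have "mpoly_monom m - p = (?q - p) + g" by simp
    also have "\<dots> \<in> J" using p(2) g(1) by (intro ideal_closed(3)[OF J])
    finally show ?thesis using p(1) by blast
  qed
qed

text \<open>A monomial outside \<open>B\<close> is itself a leading monomial. Conversely, if the
  leading monomial of some \<open>f\<close> in \<open>J\<close> divided a monomial \<open>m\<close>
  of \<open>B\<close>, a multiple of \<open>f\<close> would reduce \<open>m\<close> to smaller
  monomials of \<open>B\<close>, against independence.\<close>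

lemma standard_monos_eqI:
  fixes J :: "'a::field mpoly set"
  assumes J: "ideal J (poly_ring n)" and B: "B \<subseteq> monomials n"
    and red: "\<And>m. m \<in> monomials n \<Longrightarrow> m \<notin> B \<Longrightarrow> \<exists>g\<in>J. monic_at n m g"
    and indep: "mono_independent J B"
  shows "standard_monos n (neglex n) J = B"
proof (intro equalityI subsetI)
  fix m assume m: "m \<in> standard_monos n (neglex n) J"
  show "m \<in> B"
  proof (rule ccontr)
    assume "m \<notin> B"
    then obtain g where g: "g \<in> J" "monic_at n m g" using red m by (auto simp: standard_monos_def)
    have "g \<noteq> 0" using g by (auto simp: monic_at_def)
    moreover have "mono_dvd (leading_mono (neglex n) g) m"
      using monic_at_leading_mono[OF g(2)] by (auto simp: mono_dvd_def intro: exI[of _ 0])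
    ultimately show False using m g by (auto simp: standard_monos_def)
  qed
next
  fix m assume m: "m \<in> B"
  have "\<not> mono_dvd (leading_mono (neglex n) f) m" if f: "f \<in> J" "f \<noteq> 0" for f
  proof
    let ?l = "leading_mono (neglex n) f"
    assume "mono_dvd ?l m"
    then obtain c where c: "m = c + ?l" by (auto simp: mono_dvd_def add.commute)
    have c': "c \<in> monomials n"
    proof -
      have "Poly_Mapping.keys c \<subseteq> Poly_Mapping.keys m"
        using c by (auto simp: in_keys_iff lookup_add)
      thus ?thesis using m B by (auto simp: monomials_def)
    qed
    have fn: "f \<in> mpolys n" using f ideal_closed(1)[OF J] by auto
    note lead = leading_mono_props[OF fn f(2)]
    \<comment> \<open>Division by the leading coefficient makes this multiple of \<open>f\<close>
      monic at \<open>m\<close>; it is the reason for assuming a field.\<close>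
    let ?g = "Poly_Mapping.single c (1 / Poly_Mapping.lookup f ?l) * f"
    have g: "monic_at n m ?g"
      unfolding c using lead c' fn by (intro monic_at_single_times) (auto simp: in_keys_iff)
    have gJ: "?g \<in> J" using f c' by (intro ideal_closed(4)[OF J]) auto
    let ?q = "mpoly_monom m - ?g"
    have "\<exists>p. Poly_Mapping.keys p \<subseteq> {m'\<in>B. neglex n m' m} \<and> ?q - p \<in> J"
    proof (rule reduce_linear[OF J])
      fix m' assume m': "m' \<in> Poly_Mapping.keys ?q"
      have "m' \<noteq> m" using g m' by (auto simp: in_keys_iff mpoly_monom_def lookup_minus monic_at_def)
      hence "m' \<in> Poly_Mapping.keys ?g"
        using m' by (auto simp: in_keys_iff mpoly_monom_def lookup_minus lookup_single)
      hence m': "m' \<in> monomials n" "neglex n m' m"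
        using g \<open>m' \<noteq> m\<close> by (auto simp: monic_at_def mpolys_def)
      obtain p where p: "Poly_Mapping.keys p \<subseteq> {m''\<in>B. m'' = m' \<or> neglex n m'' m'}" "mpoly_monom m' - p \<in> J"
        using monic_at_reduce[OF J B red m'(1)] by blast
      have "Poly_Mapping.keys p \<subseteq> {m''\<in>B. neglex n m'' m}" using p(1) m'(2) neglex_trans by blast
      thus "\<exists>p. Poly_Mapping.keys p \<subseteq> {m'\<in>B. neglex n m' m} \<and> mpoly_monom m' - p \<in> J" using p(2) by blast
    qed
    then obtain p where p: "Poly_Mapping.keys p \<subseteq> {m'\<in>B. neglex n m' m}" "?q - p \<in> J" by blast
    have "mpoly_monom m - p = (?q - p) + ?g" by simp
    also have "\<dots> \<in> J" using p(2) gJ by (intro ideal_closed(3)[OF J])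
    finally have "mpoly_monom m - p \<in> J" .
    moreover have "Poly_Mapping.keys (mpoly_monom m - p) \<subseteq> B"
      using p(1) m Poly_Mapping.keys_diff[of "mpoly_monom m" p]
      by (auto simp: mpoly_monom_def split: if_splits)
    ultimately have "mpoly_monom m - p = 0" using indep by (auto simp: mono_independent_def)
    \<comment> \<open>The polynomial \<open>p\<close> would be the monomial \<open>m\<close>,
      although its support lies strictly below \<open>m\<close>.\<close>
    hence "Poly_Mapping.lookup p m = 1" by (auto simp: mpoly_monom_def)
    hence "m \<in> Poly_Mapping.keys p" by (simp add: in_keys_iff)
    thus False using p(1) by auto
  qed
  thus "m \<in> standard_monos n (neglex n) J" using m B by (auto simp: standard_monos_def)
qed


section \<open>Elementary and complete homogeneous polynomials\<close>

definition mdeg :: "mono \<Rightarrow> nat" where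
  "mdeg a = (\<Sum>i\<in>Poly_Mapping.keys a. Poly_Mapping.lookup a i)"

lemma mdeg_superset:
  "finite S \<Longrightarrow> Poly_Mapping.keys a \<subseteq> S \<Longrightarrow> mdeg a = (\<Sum>i\<in>S. Poly_Mapping.lookup a i)"
  unfolding mdeg_def by (intro sum.mono_neutral_left) (auto simp: in_keys_iff)

lemma mdeg_monomials: "a \<in> monomials n \<Longrightarrow> mdeg a = (\<Sum>i=1..n. Poly_Mapping.lookup a i)"
  by (intro mdeg_superset) (auto simp: monomials_def)

lemma mdeg_0 [simp]: "mdeg 0 = 0"
  by (simp add: mdeg_def)

lemma mdeg_single [simp]: "mdeg (Poly_Mapping.single i e) = e"
  by (simp add: mdeg_def)

lemma mdeg_add: "mdeg (a + b) = mdeg a + mdeg b"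
proof -
  let ?S = "Poly_Mapping.keys a \<union> Poly_Mapping.keys b"
  have "mdeg (a + b) = (\<Sum>i\<in>?S. Poly_Mapping.lookup (a + b) i)"
    using Poly_Mapping.keys_add[of a b] by (intro mdeg_superset) auto
  also have "\<dots> = mdeg a + mdeg b"
    by (simp add: lookup_add sum.distrib mdeg_superset[of ?S])
  finally show ?thesis .
qed

lemma lookup_le_mdeg: "Poly_Mapping.lookup a i \<le> mdeg a"
  unfolding mdeg_def by (cases "i \<in> Poly_Mapping.keys a") (auto intro: member_le_sum simp: in_keys_iff)

lemma mdeg_eq_0_iff: "mdeg a = 0 \<longleftrightarrow> a = 0"
  using lookup_le_mdeg[of a] by (auto intro!: poly_mapping_eqI)

lemma mono_split: "0 < Poly_Mapping.lookup a i \<Longrightarrow> \<exists>b. a = Poly_Mapping.single i 1 + b"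
  for a :: mono
proof (intro exI)
  assume "0 < Poly_Mapping.lookup a i"
  thus "a = Poly_Mapping.single i 1 + (a - Poly_Mapping.single i 1)"
    by (intro poly_mapping_eqI) (auto simp: lookup_add lookup_minus lookup_single when_def)
qed

lemma monomials_add_iff: "a + b \<in> monomials n \<longleftrightarrow> a \<in> monomials n \<and> b \<in> monomials n"
  by (auto simp: monomials_def in_keys_iff lookup_add subset_iff)

lemma monomials_SucD:
  assumes "a \<in> monomials (Suc n)" "Poly_Mapping.lookup a (Suc n) = 0"
  shows "a \<in> monomials n"
  unfolding monomials_def
proof (intro CollectI subsetI)
  fix i assume i: "i \<in> Poly_Mapping.keys a"
  hence "i \<noteq> Suc n" using assms by (auto simp: in_keys_iff)
  thus "i \<in> {1..n}" using i assms by (auto simp: monomials_def subset_iff le_Suc_eq)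
qed

section \<open>Recursions in the number of variables\<close>

definition hmonos :: "nat \<Rightarrow> nat \<Rightarrow> mono set" where
  "hmonos m d = {a \<in> monomials m. mdeg a = d}"

lemma hsym_eq: "hsym m d = (\<Sum>a\<in>hmonos m d. mpoly_monom a)"
  unfolding hsym_def hmonos_def by (intro sum.cong) (auto simp: mdeg_monomials)

lemma finite_hmonos: "finite (hmonos m d)"
proof -
  have "hmonos m d = {a. a \<in> monomials m \<and> (\<Sum>i=1..m. Poly_Mapping.lookup a i) = d}"
    by (auto simp: hmonos_def mdeg_monomials)
  thus ?thesis using finite_hsym_support by simp
qed

lemma lookup_hsym: "Poly_Mapping.lookup (hsym m d) a = (1 when a \<in> hmonos m d)"
  unfolding hsym_eq mpoly_monom_def by (rule lookup_sum_single[OF finite_hmonos])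

lemma keys_hsym: "Poly_Mapping.keys (hsym m d :: 'a::comm_ring_1 mpoly) = hmonos m d"
  by (auto simp: in_keys_iff lookup_hsym)

lemma hsym_mpolys [simp]: "m \<le> n \<Longrightarrow> hsym m d \<in> mpolys n"
  using monomials_mono[of m n] by (auto simp: mpolys_def keys_hsym hmonos_def)

lemma hsym_0_right [simp]: "hsym m 0 = 1"
proof -
  have "hmonos m 0 = {0}" by (auto simp: hmonos_def mdeg_eq_0_iff)
  thus ?thesis by (simp add: hsym_eq mpoly_monom_def)
qed

lemma hsym_0_left [simp]: "hsym 0 (Suc d) = 0"
proof -
  have "hmonos 0 (Suc d) = {}" by (auto simp: hmonos_def mdeg_monomials)
  thus ?thesis by (simp add: hsym_eq)
qed

text \<open>A monomial of degree d+1 either avoids the last variable or is that variable times a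
  monomial of degree d, which may contain it again; hence \<open>Suc m\<close> in the last
  factor.\<close>

lemma hsym_Suc: "hsym (Suc m) (Suc d) = hsym m (Suc d) + xvar (Suc m) * hsym (Suc m) d"
proof -
  let ?s = "Poly_Mapping.single (Suc m) 1"
  have "hmonos (Suc m) (Suc d) = hmonos m (Suc d) \<union> (+) ?s ` hmonos (Suc m) d"
  proof (intro equalityI subsetI)
    fix a assume a: "a \<in> hmonos (Suc m) (Suc d)"
    show "a \<in> hmonos m (Suc d) \<union> (+) ?s ` hmonos (Suc m) d"
    proof (cases "Poly_Mapping.lookup a (Suc m) = 0")
      case True
      thus ?thesis using a by (auto simp: hmonos_def monomials_SucD)
    next
      case False
      then obtain b where b: "a = ?s + b" using mono_split by blast
      hence "b \<in> hmonos (Suc m) d" using a by (simp add: hmonos_def monomials_add_iff mdeg_add)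
      thus ?thesis using b by blast
    qed
  next
    fix a assume "a \<in> hmonos m (Suc d) \<union> (+) ?s ` hmonos (Suc m) d"
    thus "a \<in> hmonos (Suc m) (Suc d)"
      using monomials_mono[of m "Suc m"] by (auto simp: hmonos_def mdeg_add monomials_add)
  qed
  moreover have "hmonos m (Suc d) \<inter> (+) ?s ` hmonos (Suc m) d = {}"
  proof -
    have "Poly_Mapping.lookup (?s + b) (Suc m) \<noteq> 0" for b :: mono by (simp add: lookup_add)
    moreover have "Poly_Mapping.lookup a (Suc m) = 0" if "a \<in> hmonos m (Suc d)" for a
      using that by (auto simp: hmonos_def intro!: lookup_notin_monomials)
    ultimately show ?thesis by blast
  qed
  ultimately have "(hsym (Suc m) (Suc d) :: 'a mpoly) =
      hsym m (Suc d) + (\<Sum>a\<in>(+) ?s ` hmonos (Suc m) d. mpoly_monom a)"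
    unfolding hsym_eq by (simp add: sum.union_disjoint finite_hmonos)
  also have "(\<Sum>a\<in>(+) ?s ` hmonos (Suc m) d. mpoly_monom a) = (xvar (Suc m) * hsym (Suc m) d :: 'a mpoly)"
    unfolding hsym_eq by (subst sum.reindex)
      (auto simp: sum_distrib_left xvar_def mpoly_monom_def mult_single intro!: inj_onI)
  finally show ?thesis .
qed

lemma esym_0_right [simp]: "esym m 0 = 1"
proof -
  have "{S. S \<subseteq> {1..m} \<and> card S = 0} = {{}}" by (auto dest: finite_subset)
  thus ?thesis unfolding esym_def by simp
qed

lemma esym_eq_0: "m < d \<Longrightarrow> esym m d = 0"
proof -
  assume "m < d"
  hence "\<not> (S \<subseteq> {1..m} \<and> card S = d)" for S using card_mono[of "{1..m}" S] by auto
  hence "{S. S \<subseteq> {1..m} \<and> card S = d} = {}" by blast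
  thus ?thesis unfolding esym_def by (simp only: sum.empty)
qed

text \<open>As in \<open>hsym_Suc\<close>, but a subset contains the last index at most once, so
  what remains after removing it lies in the first \<open>m\<close> indices.\<close>

lemma esym_Suc: "esym (Suc m) (Suc d) = esym m (Suc d) + xvar (Suc m) * esym m d"
proof -
  let ?E = "\<lambda>m d. {S. S \<subseteq> {1..m::nat} \<and> card S = d}"
  have fin: "finite (?E m d)" for m d by (rule finite_subset[of _ "Pow {1..m}"]) auto
  have fS: "finite S" "Suc m \<notin> S" if "S \<subseteq> {1..m}" for S using that finite_subset[OF that finite_atLeastAtMost] by auto
  have "?E (Suc m) (Suc d) = ?E m (Suc d) \<union> insert (Suc m) ` ?E m d"
  proof (intro equalityI subsetI)
    fix S assume S: "S \<in> ?E (Suc m) (Suc d)"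
    show "S \<in> ?E m (Suc d) \<union> insert (Suc m) ` ?E m d"
    proof (cases "Suc m \<in> S")
      case True
      hence "S = insert (Suc m) (S - {Suc m})" by blast
      moreover have "S - {Suc m} \<in> ?E m d"
        using S True by (auto simp: le_Suc_eq)
      ultimately show ?thesis by blast
    next
      case False
      thus ?thesis using S by (auto simp: le_Suc_eq)
    qed
  next
    fix S assume "S \<in> ?E m (Suc d) \<union> insert (Suc m) ` ?E m d"
    thus "S \<in> ?E (Suc m) (Suc d)" using fS by fastforce
  qed
  moreover have "?E m (Suc d) \<inter> insert (Suc m) ` ?E m d = {}" by auto
  moreover have "inj_on (insert (Suc m)) (?E m d)"
    using fS by (intro inj_onI) (auto simp: insert_ident)
  ultimately have "(esym (Suc m) (Suc d) :: 'a mpoly) =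
      esym m (Suc d) + (\<Sum>S\<in>?E m d. \<Prod>i\<in>insert (Suc m) S. xvar i)"
    unfolding esym_def using fin by (simp add: sum.union_disjoint sum.reindex)
  also have "(\<Sum>S\<in>?E m d. \<Prod>i\<in>insert (Suc m) S. xvar i :: 'a mpoly) = xvar (Suc m) * esym m d"
    unfolding esym_def sum_distrib_left using fS by (intro sum.cong) auto
  finally show ?thesis .
qed

lemma esym_mpolys [simp]: "m \<le> n \<Longrightarrow> esym m d \<in> mpolys n"
  unfolding esym_def by (intro mpolys_sum mpolys_prod mpolys_xvar) auto

section \<open>Generating functions built from the factors 1 - y_i t\<close>

definition linfac :: "(nat \<Rightarrow> 'a::comm_ring_1) \<Rightarrow> nat \<Rightarrow> 'a fps" where
  "linfac y i = 1 - fps_const (y i) * fps_X"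

lemma linfac_mult_nth_Suc: "fps_nth (linfac y i * F) (Suc d) = fps_nth F (Suc d) - y i * fps_nth F d"
  by (simp add: linfac_def left_diff_distrib mult.assoc)

lemma linfac_mult_nth_0: "fps_nth (linfac y i * F) 0 = fps_nth F 0"
  by (simp add: linfac_def)

lemma linfac_nth_0 [simp]: "fps_nth (linfac y i) 0 = 1"
  by (simp add: linfac_def)

lemma prod_linfac_nth_0: "fps_nth (\<Prod>i\<in>A. linfac y i) 0 = 1"
  by (induction A rule: infinite_finite_induct) (auto simp: linfac_def)

lemma prod_linfac_nth_eq_0:
  "finite A \<Longrightarrow> card A < d \<Longrightarrow> fps_nth (\<Prod>i\<in>A. linfac y i) d = 0"
proof (induction A arbitrary: d rule: finite_induct)
  case (insert a A)
  then obtain d' where "d = Suc d'" by (cases d) auto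
  thus ?case using insert by (simp add: linfac_mult_nth_Suc)
qed auto

text \<open>The identities between generating functions are needed twice: for the polynomials
  themselves, with the identity map, and for their values at a point, with the evaluation
  \<open>eval x\<close>.\<close>

locale mpoly_hom =
  fixes \<phi> :: "'a::comm_ring_1 mpoly \<Rightarrow> 'b::comm_ring_1"
  assumes hom_1: "\<phi> 1 = 1" and hom_add: "\<phi> (p + q) = \<phi> p + \<phi> q" and hom_mult: "\<phi> (p * q) = \<phi> p * \<phi> q"
begin

lemma hom_0: "\<phi> 0 = 0"
  using hom_add[of 0 0] by simp

lemma esym_fps:
  "Abs_fps (\<lambda>d. (- 1) ^ d * \<phi> (esym m d)) = (\<Prod>i=1..m. linfac (\<lambda>i. \<phi> (xvar i)) i)"
proof (induction m)
  case 0
  show ?case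
  proof (rule fps_ext)
    fix d show "fps_nth (Abs_fps (\<lambda>d. (- 1) ^ d * \<phi> (esym 0 d))) d =
        fps_nth (\<Prod>i=1..0. linfac (\<lambda>i. \<phi> (xvar i)) i) d"
      by (cases d) (auto simp: hom_1 esym_eq_0 hom_0)
  qed
next
  case (Suc m)
  have "Abs_fps (\<lambda>d. (- 1) ^ d * \<phi> (esym (Suc m) d)) =
      linfac (\<lambda>i. \<phi> (xvar i)) (Suc m) * Abs_fps (\<lambda>d. (- 1) ^ d * \<phi> (esym m d))"
  proof (rule fps_ext)
    fix d show "fps_nth (Abs_fps (\<lambda>d. (- 1) ^ d * \<phi> (esym (Suc m) d))) d =
        fps_nth (linfac (\<lambda>i. \<phi> (xvar i)) (Suc m) * Abs_fps (\<lambda>d. (- 1) ^ d * \<phi> (esym m d))) d"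
      by (cases d) (auto simp: hom_1 linfac_mult_nth_0 linfac_mult_nth_Suc esym_Suc hom_add hom_mult algebra_simps)
  qed
  thus ?case using Suc by (simp add: mult.commute)
qed

text \<open>By \<open>hsym_Suc\<close>, multiplying the series for m+1 variables by its last factor
  gives the series for m variables, so the product telescopes.\<close>

lemma hsym_fps:
  "(\<Prod>i=1..m. linfac (\<lambda>i. \<phi> (xvar i)) i) * Abs_fps (\<lambda>d. \<phi> (hsym m d)) = 1"
proof (induction m)
  case 0
  show ?case
  proof (rule fps_ext)
    fix d show "fps_nth ((\<Prod>i=1..0. linfac (\<lambda>i. \<phi> (xvar i)) i) * Abs_fps (\<lambda>d. \<phi> (hsym 0 d))) d = fps_nth 1 d"
      by (cases d) (auto simp: hom_1 hom_0)
  qed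
next
  case (Suc m)
  have "linfac (\<lambda>i. \<phi> (xvar i)) (Suc m) * Abs_fps (\<lambda>d. \<phi> (hsym (Suc m) d)) = Abs_fps (\<lambda>d. \<phi> (hsym m d))"
  proof (rule fps_ext)
    fix d show "fps_nth (linfac (\<lambda>i. \<phi> (xvar i)) (Suc m) * Abs_fps (\<lambda>d. \<phi> (hsym (Suc m) d))) d =
        fps_nth (Abs_fps (\<lambda>d. \<phi> (hsym m d))) d"
      by (cases d) (auto simp: hom_1 linfac_mult_nth_0 linfac_mult_nth_Suc hsym_Suc hom_add hom_mult)
  qed
  thus ?case using Suc by (simp add: mult.assoc)
qed

text \<open>The series of the \<open>hsym a d\<close> is the inverse of the first \<open>a\<close>
  of the \<open>n\<close> factors and cancels them.\<close>

lemma esym_hsym_fps: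
  assumes "a \<le> n"
  shows "Abs_fps (\<lambda>d. (- 1) ^ d * \<phi> (esym n d)) * Abs_fps (\<lambda>d. \<phi> (hsym a d)) =
    (\<Prod>i\<in>{a+1..n}. linfac (\<lambda>i. \<phi> (xvar i)) i)"
proof -
  have "{1..n} = {1..a} \<union> {a+1..n}" "{1..a} \<inter> {a+1..n} = {}" using assms by auto
  hence "(\<Prod>i=1..n. linfac (\<lambda>i. \<phi> (xvar i)) i) =
      (\<Prod>i=1..a. linfac (\<lambda>i. \<phi> (xvar i)) i) * (\<Prod>i\<in>{a+1..n}. linfac (\<lambda>i. \<phi> (xvar i)) i)"
    by (simp add: prod.union_disjoint)
  thus ?thesis using hsym_fps[of a] unfolding esym_fps
    by (metis (no_types, lifting) mult.assoc mult.commute mult_1_left)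
qed

end

text \<open>This is the coefficient of t^d in a product of n - a linear factors, by
  \<open>esym_hsym_fps\<close> for the identity map.\<close>

lemma esym_hsym_relation:
  assumes "a \<le> n" "n - a < d"
  shows "(\<Sum>l\<le>d. (- 1) ^ l * esym n l * hsym a (d - l)) = (0 :: 'a::comm_ring_1 mpoly)"
proof -
  interpret mpoly_hom "\<lambda>p :: 'a mpoly. p" by unfold_locales auto
  have "fps_nth (\<Prod>i\<in>{a+1..n}. linfac (\<lambda>i. xvar i :: 'a mpoly) i) d = 0"
    using assms by (intro prod_linfac_nth_eq_0) auto
  thus ?thesis
    unfolding esym_hsym_fps[OF assms(1), symmetric] fps_mult_nth by (simp add: atLeast0AtMost)
qed

section \<open>Members of the Stirling ideal\<close>

context
  fixes n k r :: nat and J :: "'a::comm_ring_1 mpoly set"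
  assumes rk: "r \<le> k" and kn: "k \<le> n" and k1: "1 \<le> k"
  defines "J \<equiv> stirling_ideal n k r"
begin

lemma stirling_ideal_is_ideal: "ideal J (poly_ring n)"
  unfolding J_def using rk kn by (intro ideal_stirling_ideal) auto

lemma gens_in_stirling_ideal: "stirling_gens n k r \<subseteq> J"
  unfolding J_def using rk kn by (intro stirling_gens_in_ideal) auto

lemma power_in_stirling_ideal: "i \<in> {1..n} \<Longrightarrow> xvar i ^ k \<in> J"
  using gens_in_stirling_ideal by (auto simp: stirling_gens_def)

lemma esym_in_stirling_ideal: "n - k < d \<Longrightarrow> esym n d \<in> J"
  using gens_in_stirling_ideal ideal_closed(2)[OF stirling_ideal_is_ideal]
  by (cases "d \<le> n") (auto simp: stirling_gens_def esym_eq_0)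

text \<open>Downward induction from \<open>r\<close>, where these are generators. Solving
  \<open>hsym_Suc\<close> for the polynomial in fewer variables leaves degrees d and d-1 in i+1
  variables, and d-1 still exceeds k-(i+1).\<close>

lemma hsym_in_stirling_ideal:
  assumes "i \<le> r" "k - i < d" "d \<le> k"
  shows "hsym i d \<in> J"
  using assms
proof (induction i arbitrary: d rule: inc_induct)
  case base
  thus ?case using gens_in_stirling_ideal by (auto simp: stirling_gens_def)
next
  case (step i)
  obtain d' where d': "d = Suc d'" using step.prems by (cases d) auto
  have "hsym i d = hsym (Suc i) d - xvar (Suc i) * hsym (Suc i) d'"
    unfolding d' hsym_Suc by simp
  also have "\<dots> \<in> J"
    using step rk kn d' by (intro ideal_closed(6)[OF stirling_ideal_is_ideal] ideal_closed(4)[OF stirling_ideal_is_ideal] step.IH) auto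
  finally show ?case .
qed

end


section \<open>Skip monomials as leading monomials\<close>

text \<open>Rows and columns count from 0, hence the \<open>+ 1\<close> in the degree. The test
  stands for the convention that h of negative degree is 0; truncated subtraction alone would give
  h_0 = 1.\<close>

definition skip_mat :: "nat \<Rightarrow> nat \<Rightarrow> (nat \<Rightarrow> nat) \<Rightarrow> 'a::comm_ring_1 mpoly mat" where
  "skip_mat k N s = mat N N (\<lambda>(i, j). if s i \<le> k + j + 1 then hsym (s i) (k + j + 1 - s i) else 0)"

lemma skip_mat_carrier [simp]: "skip_mat k N s \<in> carrier_mat N N"
  by (simp add: skip_mat_def)

lemma det_mpolys:
  fixes A :: "'a::comm_ring_1 mpoly mat"
  assumes "A \<in> carrier_mat N N" "\<And>i j. i < N \<Longrightarrow> j < N \<Longrightarrow> A $$ (i, j) \<in> mpolys n"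
  shows "det A \<in> mpolys n"
proof -
  have "signof p * (\<Prod>i = 0..<N. A $$ (i, p i)) \<in> mpolys n" if "p permutes {0..<N}" for p
  proof (intro mpolys_mult mpolys_prod)
    show "signof p \<in> mpolys n" by (simp add: sign_def)
    fix i assume "i \<in> {0..<N}"
    moreover hence "p i \<in> {0..<N}" using permutes_in_image[OF that] by blast
    ultimately show "A $$ (i, p i) \<in> mpolys n" using assms(2) by auto
  qed
  thus ?thesis unfolding det_def'[OF assms(1)] by (intro mpolys_sum) auto
qed

text \<open>The cofactor deletes row \<open>i\<close>, so the hypothesis speaks of the other rows.
  In \<open>det_skip_mat_monic\<close> these involve fewer variables than the deleted one, and so
  does the cofactor.\<close>

lemma cofactor_mpolys:
  fixes A :: "'a::comm_ring_1 mpoly mat"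
  assumes A: "A \<in> carrier_mat N N" and ij: "i < N" "j < N"
    and entries: "\<And>i' j. i' < N \<Longrightarrow> i' \<noteq> i \<Longrightarrow> j < N \<Longrightarrow> A $$ (i', j) \<in> mpolys n"
  shows "cofactor A i j \<in> mpolys n"
proof -
  have "det (mat_delete A i j) \<in> mpolys n"
  proof (rule det_mpolys)
    show "mat_delete A i j \<in> carrier_mat (N - 1) (N - 1)"
      using A mat_delete_carrier[of A N N i j] by simp
    fix a b assume ab: "a < N - 1" "b < N - 1"
    have "mat_delete A i j $$ (a, b) =
        A $$ (if a < i then a else Suc a, if b < j then b else Suc b)"
      using A ab unfolding mat_delete_def by simp
    also have "\<dots> \<in> mpolys n" using ab by (intro entries) auto
    finally show "mat_delete A i j $$ (a, b) \<in> mpolys n" .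
  qed
  thus ?thesis unfolding cofactor_def by (intro mpolys_mult mpolys_power) auto
qed

text \<open>
  The rows of \<^term>\<open>skip_mat k (n - k + 1) s\<close> are annihilated modulo the ideal by the vector of
  signed elementary symmetric polynomials, whose last entry is 1.
\<close>

lemma det_skip_mat_in_ideal:
  fixes n k r :: nat
  assumes rk: "r \<le> k" and kn: "k \<le> n" and k1: "1 \<le> k"
  defines "J \<equiv> stirling_ideal n k r :: 'a::comm_ring_1 mpoly set"
  assumes s: "\<And>i. i < n - k + 1 \<Longrightarrow> s i \<in> {1..n}"
  shows "det (skip_mat k (n - k + 1) s) \<in> J"
proof -
  have J: "ideal J (poly_ring n)" unfolding J_def by (rule stirling_ideal_is_ideal[OF assms(1-3)])
  define N where "N = n - k + 1"
  let ?A = "skip_mat k N s :: 'a mpoly mat"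
  \<comment> \<open>The order is reversed: the last column meets e_0 = 1, and the column at distance
    l from it meets the signed e_l.\<close>
  define v :: "nat \<Rightarrow> 'a mpoly" where "v j = (- 1) ^ (N - Suc j) * esym n (N - Suc j)" for j
  have A: "?A \<in> carrier_mat N N" by simp
  have entries: "?A $$ (i, j) \<in> mpolys n" if "i < N" "j < N" for i j
    using that s[of i] by (auto simp: skip_mat_def N_def)
  have row: "(\<Sum>j<N. ?A $$ (i, j) * v j) \<in> J" if i: "i < N" for i
  proof -
    \<comment> \<open>The least degree above n - s_i, that is, the first one in which
      \<open>esym_hsym_relation\<close> holds for a = s_i. It is also the degree of the entry in the
      last column.\<close>
    define d where "d = n + 1 - s i"
    have si: "1 \<le> s i" "s i \<le> n" using s[of i] i by (auto simp: N_def)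
    define t :: "nat \<Rightarrow> 'a mpoly" where
      "t l = (if l \<le> d then (- 1) ^ l * esym n l * hsym (s i) (d - l) else 0)" for l
    have "(\<Sum>j<N. ?A $$ (i, j) * v j) = (\<Sum>l<N. ?A $$ (i, N - Suc l) * v (N - Suc l))"
      by (rule sum.nat_diff_reindex[symmetric])
    also have "\<dots> = (\<Sum>l<N. t l)"
    proof (intro sum.cong refl)
      fix l assume l: "l \<in> {..<N}"
      have "?A $$ (i, N - Suc l) = (if l \<le> d then hsym (s i) (d - l) else 0)"
      proof -
        have 1: "k + (N - Suc l) + 1 = n + 1 - l" using l kn by (auto simp: N_def)
        have 2: "s i \<le> n + 1 - l \<longleftrightarrow> l \<le> d" using si l kn by (auto simp: d_def N_def)
        have 3: "n + 1 - l - s i = d - l" by (simp add: d_def)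
        have "?A $$ (i, N - Suc l) =
            (if s i \<le> k + (N - Suc l) + 1 then hsym (s i) (k + (N - Suc l) + 1 - s i) else 0)"
          using i l by (simp add: skip_mat_def)
        thus ?thesis unfolding 1 2 3 .
      qed
      moreover have "v (N - Suc l) = (- 1) ^ l * esym n l" using l by (simp add: v_def)
      ultimately show "?A $$ (i, N - Suc l) * v (N - Suc l) = t l" by (simp add: t_def mult_ac)
    qed
    \<comment> \<open>The full relation sums to 0. The row contributes the terms with l < N, so it
      equals minus the remaining ones, each a multiple of some e_l with l > n - k.\<close>
    also have "\<dots> = - (\<Sum>l=N..n. t l)"
    proof -
      have "n - s i < d" using si by (simp add: d_def)
      hence "(\<Sum>l\<le>d. t l) = 0"
        using esym_hsym_relation[of "s i" n d] si by (simp add: t_def)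
      moreover have "(\<Sum>l\<le>n. t l) = (\<Sum>l\<le>d. t l)"
        using si by (intro sum.mono_neutral_right) (auto simp: t_def d_def)
      moreover have "(\<Sum>l\<le>n. t l) = (\<Sum>l<N. t l) + (\<Sum>l=N..n. t l)"
      proof -
        have "{..n} = {..<N} \<union> {N..n}" using kn k1 by (auto simp: N_def)
        thus ?thesis by (simp add: sum.union_disjoint ivl_disj_int)
      qed
      ultimately show ?thesis by (simp add: eq_neg_iff_add_eq_0)
    qed
    also have "\<dots> \<in> J"
    proof (intro ideal_closed(5)[OF J] ideal_closed(7)[OF J])
      fix l assume l: "l \<in> {N..n}"
      have "esym n l \<in> J" unfolding J_def using l by (intro esym_in_stirling_ideal[OF assms(1-3)]) (auto simp: N_def)
      hence "((- 1) ^ l * hsym (s i) (d - l)) * esym n l \<in> J"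
        using si by (intro ideal_closed(4)[OF J] mpolys_mult mpolys_power) auto
      thus "t l \<in> J" by (simp add: t_def mult_ac ideal_closed(2)[OF J])
    qed
    finally show ?thesis .
  qed
  have N: "N - 1 < N" by (simp add: N_def)
  \<comment> \<open>Weighting the rows by the last row of the adjugate turns their pairings with
    \<open>v\<close> into the determinant times the last entry of \<open>v\<close>, which is 1. So
    the determinant is a combination of elements of the ideal.\<close>
  let ?B = "adj_mat ?A"
  have B: "?B \<in> carrier_mat N N" by (rule adj_mat(1)[OF A])
  have prod: "(\<Sum>i<N. ?B $$ (N - 1, i) * ?A $$ (i, j)) = (if j = N - 1 then det ?A else 0)"
    if j: "j < N" for j
  proof -
    have "(?B * ?A) $$ (N - 1, j) = (\<Sum>i<N. ?B $$ (N - 1, i) * ?A $$ (i, j))"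
      using j N carrier_matD[OF A] carrier_matD[OF B] by (simp add: scalar_prod_def lessThan_atLeast0)
    moreover have "(?B * ?A) $$ (N - 1, j) = (det ?A \<cdot>\<^sub>m 1\<^sub>m N) $$ (N - 1, j)"
      by (simp add: adj_mat(3)[OF A])
    ultimately show ?thesis using N j by auto
  qed
  have "(\<Sum>i<N. ?B $$ (N - 1, i) * (\<Sum>j<N. ?A $$ (i, j) * v j)) =
      (\<Sum>j<N. (\<Sum>i<N. ?B $$ (N - 1, i) * ?A $$ (i, j)) * v j)"
    unfolding sum_distrib_left sum_distrib_right by (subst sum.swap) (simp add: mult.assoc)
  also have "\<dots> = (\<Sum>j<N. if j = N - 1 then det ?A * v j else 0)"
    by (intro sum.cong refl, subst prod) auto
  also have "\<dots> = det ?A" using N by (simp add: v_def)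
  finally have "det ?A = (\<Sum>i<N. ?B $$ (N - 1, i) * (\<Sum>j<N. ?A $$ (i, j) * v j))" ..
  also have "\<dots> \<in> J"
  proof (rule ideal_closed(7)[OF J])
    fix i assume i: "i \<in> {..<N}"
    have "?B $$ (N - 1, i) = cofactor ?A i (N - 1)" using i N carrier_matD[OF A] by (simp add: adj_mat_def)
    also have "\<dots> \<in> mpolys n" using i N entries by (intro cofactor_mpolys[OF A]) auto
    finally show "?B $$ (N - 1, i) * (\<Sum>j<N. ?A $$ (i, j) * v j) \<in> J"
      using i by (intro ideal_closed(4)[OF J] row) auto
  qed
  finally show ?thesis by (simp add: N_def)
qed

lemma monic_at_add:
  assumes "monic_at n m g" "h \<in> mpolys n" "\<And>m'. m' \<in> Poly_Mapping.keys h \<Longrightarrow> neglex n m' m"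
  shows "monic_at n m (g + h)"
proof -
  have "m \<notin> Poly_Mapping.keys h" using assms(3)[of m] by auto
  hence "Poly_Mapping.lookup (g + h) m = 1" using assms(1) by (simp add: monic_at_def lookup_add in_keys_iff)
  thus ?thesis using assms Poly_Mapping.keys_add[of g h] by (auto simp: monic_at_def)
qed

text \<open>With \<open>f\<close> written as its leading monomial plus smaller terms, the first part
  times \<open>g\<close> is monic at m+m' and the rest contributes only smaller monomials, since the
  order respects multiplication.\<close>

lemma monic_at_mult:
  fixes f g :: "'a::comm_ring_1 mpoly"
  assumes f: "monic_at n m f" and g: "monic_at n m' g"
  shows "monic_at n (m + m') (f * g)"
proof -
  let ?h = "f - mpoly_monom m"
  have mn: "m \<in> monomials n" using f by (auto simp: monic_at_def mpolys_def in_keys_iff subset_iff)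
  have h: "neglex n a m" if "a \<in> Poly_Mapping.keys ?h" for a
  proof -
    have "a \<noteq> m" using f that by (auto simp: in_keys_iff mpoly_monom_def lookup_minus monic_at_def)
    hence "a \<in> Poly_Mapping.keys f"
      using that by (auto simp: in_keys_iff mpoly_monom_def lookup_minus lookup_single)
    thus ?thesis using f \<open>a \<noteq> m\<close> by (auto simp: monic_at_def)
  qed
  have "monic_at n (m + m') (mpoly_monom m * g)"
    unfolding mpoly_monom_def using g mn by (intro monic_at_single_times) (auto simp: monic_at_def)
  moreover have "?h * g \<in> mpolys n" using f g mn by (auto simp: monic_at_def)
  moreover have "neglex n c (m + m')" if c: "c \<in> Poly_Mapping.keys (?h * g)" for c
  proof -
    obtain a b where ab: "c = a + b" "a \<in> Poly_Mapping.keys ?h" "b \<in> Poly_Mapping.keys g"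
      using c Poly_Mapping.keys_mult[of ?h g] by blast
    have 1: "neglex n (a + b) (m + b)" using neglex_add[OF h[OF ab(2)], of b] by (simp add: add.commute)
    show ?thesis
    proof (cases "b = m'")
      case False
      hence "neglex n (m + b) (m + m')" using g ab by (intro neglex_add) (auto simp: monic_at_def)
      thus ?thesis using 1 ab neglex_trans by blast
    qed (use 1 ab in simp)
  qed
  ultimately have "monic_at n (m + m') (mpoly_monom m * g + ?h * g)" by (rule monic_at_add)
  thus ?thesis by (simp add: algebra_simps)
qed

lemma neglexI_top:
  assumes "a \<in> monomials i" "b \<in> monomials i" "i \<in> {1..n}" "Poly_Mapping.lookup a i < Poly_Mapping.lookup b i"
  shows "neglex n a b"
  unfolding neglex_def using assms
  by (intro bexI[of _ i]) (auto simp: lookup_notin_monomials)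

text \<open>Among monomials of degree d in the first i variables, only the pure power of the i-th
  has exponent d there; every other one is smaller already at its top variable.\<close>

lemma monic_at_hsym:
  assumes "i \<in> {1..n}"
  shows "monic_at n (Poly_Mapping.single i d) (hsym i d :: 'a::comm_ring_1 mpoly)"
  unfolding monic_at_def
proof (intro conjI ballI impI)
  show "hsym i d \<in> (mpolys n :: 'a mpoly set)" using assms by simp
  show "Poly_Mapping.lookup (hsym i d :: 'a mpoly) (Poly_Mapping.single i d) = 1"
    using assms by (auto simp: lookup_hsym hmonos_def)
  fix m assume "m \<in> Poly_Mapping.keys (hsym i d :: 'a mpoly)" and ne: "m \<noteq> Poly_Mapping.single i d"
  hence m: "m \<in> monomials i" "mdeg m = d" by (auto simp: keys_hsym hmonos_def)
  have "Poly_Mapping.lookup m i \<noteq> d"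
  proof
    assume eq: "Poly_Mapping.lookup m i = d"
    let ?c = "m - Poly_Mapping.single i d"
    have split: "m = Poly_Mapping.single i d + ?c"
      using eq by (intro poly_mapping_eqI) (auto simp: lookup_add lookup_minus lookup_single when_def)
    hence "mdeg m = d + mdeg ?c" by (metis mdeg_add mdeg_single)
    hence "?c = 0" using m by (simp add: mdeg_eq_0_iff)
    thus False using split ne by simp
  qed
  hence "Poly_Mapping.lookup m i < d" using lookup_le_mdeg[of m i] m by simp
  thus "neglex n m (Poly_Mapping.single i d)"
    using assms m by (intro neglexI_top[of _ i]) auto
qed

text \<open>Expansion along the last row shows that the diagonal product dominates. The earlier rows
  involve only variables before x_{s_N}, so the exponent of x_{s_N} comes from the last row alone,
  and it can reach k+N+1-s_N only in the last column, the other entries having smaller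
  degree.\<close>

lemma det_skip_mat_monic:
  assumes "\<And>i. i < N \<Longrightarrow> s i \<in> {1..n}" "\<And>i. i < N \<Longrightarrow> s i \<le> k + i"
    "\<And>i j. i < j \<Longrightarrow> j < N \<Longrightarrow> s i < s j"
  shows "monic_at n (\<Sum>j<N. Poly_Mapping.single (s j) (k + j + 1 - s j))
    (det (skip_mat k N s :: 'a::comm_ring_1 mpoly mat))"
  using assms
proof (induction N)
  case 0
  have "det (skip_mat k 0 s :: 'a mpoly mat) = 1" by (rule det_dim_zero) simp
  thus ?case by (simp add: monic_at_def)
next
  case (Suc N)
  let ?A = "skip_mat k (Suc N) s :: 'a mpoly mat"
  let ?M = "\<lambda>N. \<Sum>j<N. Poly_Mapping.single (s j) (k + j + 1 - s j)"
  have sN: "s N \<in> {1..n}" "s N \<le> k + N" using Suc.prems by auto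
  have "mat_delete ?A N N = skip_mat k N s"
    by (rule eq_matI) (auto simp: mat_delete_def skip_mat_def)
  hence cof: "cofactor ?A N N = det (skip_mat k N s)" by (simp add: cofactor_def flip: mult_2)
  have entry: "?A $$ (N, j) = (if s N \<le> k + j + 1 then hsym (s N) (k + j + 1 - s N) else 0)" if "j < Suc N" for j
    using that by (simp add: skip_mat_def)
  have "det ?A = (\<Sum>j<Suc N. ?A $$ (N, j) * cofactor ?A N j)"
    by (rule laplace_expansion_row) auto
  also have "\<dots> = hsym (s N) (k + N + 1 - s N) * det (skip_mat k N s) + (\<Sum>j<N. ?A $$ (N, j) * cofactor ?A N j)"
    using entry[of N] sN by (simp add: cof)
  finally have det: "det ?A = \<dots>" .
  have "monic_at n (?M N) (det (skip_mat k N s :: 'a mpoly mat))"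
    using Suc.prems by (intro Suc.IH) auto
  hence "monic_at n (Poly_Mapping.single (s N) (k + N + 1 - s N) + ?M N)
      (hsym (s N) (k + N + 1 - s N) * det (skip_mat k N s :: 'a mpoly mat))"
    by (intro monic_at_mult monic_at_hsym sN)
  hence main: "monic_at n (?M (Suc N)) (hsym (s N) (k + N + 1 - s N) * det (skip_mat k N s :: 'a mpoly mat))"
    by (simp add: add.commute)
  have M_mono: "?M (Suc N) \<in> monomials (s N)"
  proof (rule monomials_sum)
    fix j assume "j \<in> {..<Suc N}"
    hence "s j \<in> {1..s N}" using Suc.prems(1)[of j] Suc.prems(3)[of j N] by (cases "j = N") auto
    thus "Poly_Mapping.single (s j) (k + j + 1 - s j) \<in> monomials (s N)" by simp
  qed
  have M_lookup: "Poly_Mapping.lookup (?M (Suc N)) (s N) = k + N + 1 - s N"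
  proof -
    have "Poly_Mapping.lookup (Poly_Mapping.single (s j) (k + j + 1 - s j)) (s N) = 0" if "j < N" for j
      using Suc.prems(3)[of j N] that by (simp add: lookup_single)
    thus ?thesis by (simp add: lookup_sum lookup_add)
  qed
  have lower: "?A $$ (N, j) * cofactor ?A N j \<in> mpolys n \<and>
      (\<forall>m\<in>Poly_Mapping.keys (?A $$ (N, j) * cofactor ?A N j). neglex n m (?M (Suc N)))" if j: "j < N" for j
  proof (cases "s N \<le> k + j + 1")
    case True
    have "?A $$ (i, j') \<in> mpolys (s N - 1)" if "i < Suc N" "i \<noteq> N" "j' < Suc N" for i j'
    proof -
      have "s i \<le> s N - 1" using Suc.prems(3)[of i N] that by auto
      thus ?thesis using that by (simp add: skip_mat_def)
    qed
    hence cofj: "cofactor ?A N j \<in> mpolys (s N - 1)"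
      using j by (intro cofactor_mpolys[of _ "Suc N"]) auto
    have "neglex n m (?M (Suc N))" if m: "m \<in> Poly_Mapping.keys (?A $$ (N, j) * cofactor ?A N j)" for m
    proof -
      obtain a b where ab: "m = a + b" "a \<in> Poly_Mapping.keys (?A $$ (N, j))"
        "b \<in> Poly_Mapping.keys (cofactor ?A N j)"
        using m Poly_Mapping.keys_mult[of "?A $$ (N, j)" "cofactor ?A N j"] by blast
      have a: "a \<in> monomials (s N)" "mdeg a = k + j + 1 - s N"
        using ab(2) entry[of j] j True by (auto simp: keys_hsym hmonos_def)
      have b: "b \<in> monomials (s N - 1)" using ab(3) cofj by (auto simp: mpolys_def)
      have "Poly_Mapping.lookup b (s N) = 0" using sN by (intro lookup_notin_monomials[OF b]) auto
      hence "Poly_Mapping.lookup m (s N) \<le> k + j + 1 - s N"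
        using ab(1) a(2) lookup_le_mdeg[of a "s N"] by (simp add: lookup_add)
      also have "\<dots> < k + N + 1 - s N" using True j by auto
      finally have "Poly_Mapping.lookup m (s N) < Poly_Mapping.lookup (?M (Suc N)) (s N)" unfolding M_lookup .
      moreover have "m \<in> monomials (s N)"
        using ab(1) a(1) b monomials_mono[of "s N - 1" "s N"] monomials_add by auto
      ultimately show ?thesis using sN M_mono by (intro neglexI_top[of _ "s N"])
    qed
    moreover have "?A $$ (N, j) * cofactor ?A N j \<in> mpolys n"
      using cofj entry[of j] j sN by (intro mpolys_mult) (auto intro: mpolys_mono[rotated])
    ultimately show ?thesis by blast
  next
    case False
    thus ?thesis using entry[of j] j by simp
  qed
  show ?case
    unfolding det
  proof (rule monic_at_add[OF main])
    show "(\<Sum>j<N. ?A $$ (N, j) * cofactor ?A N j) \<in> mpolys n" using lower by (intro mpolys_sum) auto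
    fix m assume "m \<in> Poly_Mapping.keys (\<Sum>j<N. ?A $$ (N, j) * cofactor ?A N j)"
    then obtain j where "j < N" "m \<in> Poly_Mapping.keys (?A $$ (N, j) * cofactor ?A N j)"
      using keys_sum_subset[of "\<lambda>j. ?A $$ (N, j) * cofactor ?A N j" "{..<N}"] by blast
    thus "neglex n m (?M (Suc N))" using lower by blast
  qed
qed


section \<open>Greedy words and codes\<close>

text \<open>Computed from the word alone, before any partition is known. By
  \<open>ex_insertion\<close> it counts the blocks that are still empty after the insertion of 1,
  ..., i.\<close>

fun empty_blocks :: "nat \<Rightarrow> (nat \<Rightarrow> nat) \<Rightarrow> nat \<Rightarrow> nat" where
  "empty_blocks k c 0 = k"
| "empty_blocks k c (Suc i) =
     (if c (Suc i) < empty_blocks k c i then empty_blocks k c i - 1 else empty_blocks k c i)"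

text \<open>The conditions mirror the three families of generators: powers of variables, complete
  homogeneous polynomials, and, through the determinants of \<open>skip_mat\<close>, elementary
  symmetric polynomials.\<close>

definition greedy_word :: "nat \<Rightarrow> nat \<Rightarrow> nat \<Rightarrow> (nat \<Rightarrow> nat) \<Rightarrow> bool" where
  "greedy_word n k r c \<longleftrightarrow>
     (\<forall>i\<in>{1..n}. c i < k) \<and> (\<forall>i\<in>{1..r}. c i + i \<le> k) \<and> empty_blocks k c n = 0"

text \<open>Each letter either fills an empty block or is counted in the set on the right. A letter
  below \<open>empty_blocks\<close> forces that number to be positive, so its decrement never
  truncates.\<close>

lemma empty_blocks_count:
  "empty_blocks k c i + i = k + card {a \<in> {1..i}. empty_blocks k c (a - 1) \<le> c a}"
proof (induction i)
  case (Suc i)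
  let ?T = "\<lambda>i. {a \<in> {1..i}. empty_blocks k c (a - 1) \<le> c a}"
  show ?case
  proof (cases "c (Suc i) < empty_blocks k c i")
    case True
    hence "?T (Suc i) = ?T i" by (auto simp: le_Suc_eq)
    thus ?thesis using Suc True by simp
  next
    case False
    hence "?T (Suc i) = insert (Suc i) (?T i)" by (auto simp: le_Suc_eq)
    thus ?thesis using Suc False by simp
  qed
qed simp

lemma empty_blocks_antimono: "i \<le> j \<Longrightarrow> empty_blocks k c j \<le> empty_blocks k c i"
  by (induction j rule: dec_induct) auto

lemma strict_mono_on_card_less:
  fixes T :: "nat set"
  assumes h: "bij_betw h {..<card T} T" "strict_mono_on {..<card T} h" and j: "j < card T"
  shows "card {a \<in> T. a < h j} = j" "card {a \<in> T. h j < a} = card T - Suc j"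
proof -
  have less: "h i < h i' \<longleftrightarrow> i < i'" if "i < card T" "i' < card T" for i i'
    using strict_mono_on_less[OF h(2)] that by simp
  have inj: "inj_on h {..<card T}" using h(1) by (simp add: bij_betw_def)
  have T: "T = h ` {..<card T}" using h(1) by (simp add: bij_betw_def)
  have "{a \<in> T. a < h j} = h ` {..<j}" using less j by (subst (1) T) force
  thus "card {a \<in> T. a < h j} = j"
    using card_image[OF inj_on_subset[OF inj, of "{..<j}"]] j by auto
  have "{a \<in> T. h j < a} = h ` {Suc j..<card T}" using less j by (subst (1) T) force
  moreover have "{Suc j..<card T} \<subseteq> {..<card T}" by auto
  ultimately show "card {a \<in> T. h j < a} = card T - Suc j"
    using card_image[OF inj_on_subset[OF inj, of "{Suc j..<card T}"]] by simp
qed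

text \<open>Every rank occurs, counted from either end. \<open>ex_insertion\<close> picks an empty
  block by its rank from the right and an occupied one by its rank from the left.\<close>

lemma ex_card_less:
  fixes T :: "nat set"
  assumes "finite T" "c < card T"
  shows "\<exists>j\<in>T. card {a \<in> T. a < j} = c" "\<exists>j\<in>T. card {a \<in> T. j < a} = c"
proof -
  obtain h where h: "bij_betw h {..<card T} T" "strict_mono_on {..<card T} h"
    using ex_bij_betw_strict_mono_card[OF assms(1)] by blast
  have mem: "h j \<in> T" if "j < card T" for j using h(1) that by (auto simp: bij_betw_def)
  show "\<exists>j\<in>T. card {a \<in> T. a < j} = c"
    using strict_mono_on_card_less(1)[OF h assms(2)] mem[OF assms(2)] by blast
  have "card T - Suc c < card T" using assms(2) by simp
  thus "\<exists>j\<in>T. card {a \<in> T. j < a} = c"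
    using strict_mono_on_card_less(2)[OF h, of "card T - Suc c"] mem[of "card T - Suc c"] assms(2)
    by (intro bexI[of _ "h (card T - Suc c)"]) auto
qed

lemma monic_at_multiple:
  fixes J :: "'a::comm_ring_1 mpoly set"
  assumes J: "ideal J (poly_ring n)" and g: "g \<in> J" "monic_at n a g"
    and m: "m \<in> monomials n" and le: "\<And>i. Poly_Mapping.lookup a i \<le> Poly_Mapping.lookup m i"
  shows "\<exists>g\<in>J. monic_at n m g"
proof -
  let ?c = "m - a"
  have split: "m = ?c + a"
    using le by (intro poly_mapping_eqI) (auto simp: lookup_add lookup_minus)
  have c: "?c \<in> monomials n" using m split monomials_add_iff[of ?c a n] by simp
  have "monic_at n (?c + a) (Poly_Mapping.single ?c 1 * g)"
    using g c by (intro monic_at_single_times) (auto simp: monic_at_def)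
  moreover have "Poly_Mapping.single ?c 1 * g \<in> J" using c g by (intro ideal_closed(4)[OF J]) auto
  ultimately show ?thesis using split by auto
qed

lemma power_xvar: "xvar i ^ e = mpoly_monom (Poly_Mapping.single i e)"
  by (induction e) (auto simp: xvar_def mpoly_monom_def mult_single single_add[symmetric] add.commute)

lemma not_greedy_word_reducible:
  fixes n k r :: nat
  assumes rk: "r \<le> k" and kn: "k \<le> n" and k1: "1 \<le> k"
    and m: "m \<in> monomials n" and ng: "\<not> greedy_word n k r (Poly_Mapping.lookup m)"
  shows "\<exists>g \<in> (stirling_ideal n k r :: 'a::comm_ring_1 mpoly set). monic_at n m g"
proof -
  let ?J = "stirling_ideal n k r :: 'a mpoly set"
  let ?c = "Poly_Mapping.lookup m"
  note J = stirling_ideal_is_ideal[OF rk kn k1, where 'a = 'a]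
  note multiple = monic_at_multiple[OF J _ _ m]
  consider (power) i where "i \<in> {1..n}" "k \<le> ?c i"
    | (hom) i where "i \<in> {1..r}" "k < ?c i + i"
    | (skip) "0 < empty_blocks k ?c n"
    using ng by (auto simp: greedy_word_def not_less not_le)
  thus ?thesis
  proof cases
    case power
    have "monic_at n (Poly_Mapping.single i k) (xvar i ^ k :: 'a mpoly)"
      using power by (auto simp: monic_at_def power_xvar mpoly_monom_def)
    thus ?thesis using power power_in_stirling_ideal[OF rk kn k1, of i]
      by (intro multiple) (auto simp: lookup_single when_def)
  next
    case hom
    hence "monic_at n (Poly_Mapping.single i (k - i + 1)) (hsym i (k - i + 1) :: 'a mpoly)"
      using rk kn by (intro monic_at_hsym) auto
    moreover have "hsym i (k - i + 1) \<in> ?J" using hom rk by (intro hsym_in_stirling_ideal[OF rk kn k1]) auto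
    ultimately show ?thesis using hom rk by (intro multiple) (auto simp: lookup_single when_def)
  next
    case skip
    define N where "N = n - k + 1"
    define T where "T = {a \<in> {1..n}. empty_blocks k ?c (a - 1) \<le> ?c a}"
    have finT: "finite T" by (simp add: T_def)
    obtain s where s: "bij_betw s {..<card T} T" "strict_mono_on {..<card T} s"
      using ex_bij_betw_strict_mono_card[OF finT] by blast
    \<comment> \<open>By the count at \<open>n\<close>, the size of \<open>T\<close> is n - k plus
      the number of blocks left empty, which is positive here.\<close>
    have NT: "N \<le> card T" using empty_blocks_count[of k ?c n] skip kn by (simp add: N_def T_def)
    have sT: "s j \<in> T" if "j < N" for j using s(1) NT that by (auto simp: bij_betw_def)
    \<comment> \<open>Exactly j letters before position s_j open no block, so the exponent of
      x_{s_j} in the leading monomial is the number of blocks empty just before s_j. Membership in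
      \<open>T\<close> bounds it by the letter there, which is the divisibility shown below.\<close>
    have exponent: "empty_blocks k ?c (s j - 1) = k + j + 1 - s j" "s j \<le> k + j" if j: "j < N" for j
    proof -
      have "{a \<in> T. a < s j} = {a \<in> {1..s j - 1}. empty_blocks k ?c (a - 1) \<le> ?c a}"
        using sT[OF j] by (auto simp: T_def)
      hence "card {a \<in> {1..s j - 1}. empty_blocks k ?c (a - 1) \<le> ?c a} = j"
        using strict_mono_on_card_less(1)[OF s, of j] NT j by simp
      hence *: "empty_blocks k ?c (s j - 1) + (s j - 1) = k + j"
        using empty_blocks_count[of k ?c "s j - 1"] by simp
      have "1 \<le> s j" "s j \<le> n" using sT[OF j] by (auto simp: T_def)
      moreover have "empty_blocks k ?c n \<le> empty_blocks k ?c (s j - 1)"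
        using \<open>s j \<le> n\<close> by (intro empty_blocks_antimono) auto
      ultimately show "empty_blocks k ?c (s j - 1) = k + j + 1 - s j" "s j \<le> k + j"
        using * skip by auto
    qed
    let ?g = "det (skip_mat k N s) :: 'a mpoly"
    let ?M = "\<Sum>j<N. Poly_Mapping.single (s j) (k + j + 1 - s j)"
    have "monic_at n ?M ?g"
    proof (rule det_skip_mat_monic)
      show "s i \<in> {1..n}" if "i < N" for i using sT[OF that] by (auto simp: T_def)
      show "s i \<le> k + i" if "i < N" for i using exponent(2)[OF that] .
      show "s i < s j" if "i < j" "j < N" for i j
        using s(2) NT that by (auto simp: strict_mono_on_def)
    qed
    moreover have "?g \<in> ?J"
      using sT unfolding N_def by (intro det_skip_mat_in_ideal[OF rk kn k1]) (auto simp: T_def)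
    moreover have "Poly_Mapping.lookup ?M i \<le> ?c i" for i
    proof (cases "\<exists>j<N. s j = i")
      case True
      then obtain j where j: "j < N" "s j = i" by blast
      have "Poly_Mapping.lookup ?M i = (\<Sum>j'<N. if j' = j then k + j + 1 - s j else 0)"
        unfolding lookup_sum
      proof (intro sum.cong refl)
        fix j' assume j': "j' \<in> {..<N}"
        have "s j' = s j \<longleftrightarrow> j' = j"
          using s(1) NT j j' by (auto simp: bij_betw_def inj_on_def)
        thus "Poly_Mapping.lookup (Poly_Mapping.single (s j') (k + j' + 1 - s j')) i =
            (if j' = j then k + j + 1 - s j else 0)"
          using j by (auto simp: lookup_single when_def)
      qed
      also have "\<dots> = empty_blocks k ?c (s j - 1)" using j(1) exponent(1)[OF j(1)] by simp
      also have "\<dots> \<le> ?c i" using sT[OF j(1)] j by (simp add: T_def)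
      finally show ?thesis .
    next
      case False
      hence "Poly_Mapping.lookup ?M i = 0" by (auto simp: lookup_sum lookup_single when_def)
      thus ?thesis by simp
    qed
    ultimately show ?thesis by (intro multiple)
  qed
qed

text \<open>The value \<open>f a\<close> is the block that receives \<open>a\<close>; the image of
  \<open>{1..<a}\<close> is the set of blocks occupied before. The last equation is the coinversion
  code, with "not the minimum of its block" read as "its block is already occupied".\<close>

definition insertion_step :: "nat \<Rightarrow> (nat \<Rightarrow> nat) \<Rightarrow> (nat \<Rightarrow> nat) \<Rightarrow> nat \<Rightarrow> bool" where
  "insertion_step k c f a \<longleftrightarrow> f a < k \<and>
     (f a \<notin> f ` {1..<a} \<longleftrightarrow> c a < empty_blocks k c (a - 1)) \<and>
     c a = card {l. f a < l \<and> l < k \<and> l \<notin> f ` {1..<a}} + (if f a \<in> f ` {1..<a} then f a else 0)"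

text \<open>The blocks are chosen one letter at a time: a letter c below the number E of empty
  blocks selects the empty block with c empty ones to its right, and any other letter selects the
  occupied block with c - E occupied ones to its left.\<close>

lemma ex_insertion:
  assumes "\<And>a. a \<in> {1..i} \<Longrightarrow> c a < k"
  shows "\<exists>f. (\<forall>a\<in>{1..i}. insertion_step k c f a) \<and> card (f ` {1..i}) + empty_blocks k c i = k"
  using assms
proof (induction i)
  case (Suc i)
  then obtain f where f: "\<forall>a\<in>{1..i}. insertion_step k c f a"
    "card (f ` {1..i}) + empty_blocks k c i = k" by auto
  define U where "U = f ` {1..i}"
  define W where "W = {..<k} - U"
  have U: "U \<subseteq> {..<k}" using f(1) by (auto simp: U_def insertion_step_def)
  have finU: "finite U" by (simp add: U_def)
  have W: "card W = empty_blocks k c i" "finite W"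
    using f(2)[folded U_def] U finU by (simp_all add: W_def card_Diff_subset)
  have "\<exists>j<k. (j \<notin> U \<longleftrightarrow> c (Suc i) < empty_blocks k c i) \<and>
      c (Suc i) = card {l \<in> W. j < l} + (if j \<in> U then j else 0)"
  proof (cases "c (Suc i) < empty_blocks k c i")
    case True
    then obtain j where "j \<in> W" "card {l \<in> W. j < l} = c (Suc i)"
      using ex_card_less(2)[of W "c (Suc i)"] W by auto
    thus ?thesis using True by (intro exI[of _ j]) (auto simp: W_def)
  next
    case False
    have "c (Suc i) < k" using Suc.prems by simp
    \<comment> \<open>The index j counts the blocks to the left, occupied or empty. Added to the
      empty ones on the right, it gives all empty blocks plus the occupied ones on the left of j, so
      the latter must number c - E.\<close>
    hence "c (Suc i) - card W < card U" using False W f(2) by (auto simp: U_def)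
    then obtain j where j: "j \<in> U" "card {l \<in> U. l < j} = c (Suc i) - card W"
      using ex_card_less(1)[OF finU] by blast
    have "card {..<j} = card {l \<in> U. l < j} + card {l \<in> W. l < j}"
    proof -
      have "{..<j} = {l \<in> U. l < j} \<union> {l \<in> W. l < j}" using j U by (auto simp: W_def)
      moreover have "{l \<in> U. l < j} \<inter> {l \<in> W. l < j} = {}" by (auto simp: W_def)
      ultimately show ?thesis using finU W(2) by (simp add: card_Un_disjoint)
    qed
    moreover have "card W = card {l \<in> W. l < j} + card {l \<in> W. j < l}"
    proof -
      have "j \<notin> W" using j by (simp add: W_def)
      hence "W = {l \<in> W. l < j} \<union> {l \<in> W. j < l}" by (auto simp: not_less_iff_gr_or_eq)
      moreover have "{l \<in> W. l < j} \<inter> {l \<in> W. j < l} = {}" by auto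
      ultimately show ?thesis using W(2) by (metis (no_types, lifting) card_Un_disjoint finite_Un)
    qed
    ultimately have "c (Suc i) = card {l \<in> W. j < l} + j" using j(2) False W(1) by simp
    thus ?thesis using j U False by (intro exI[of _ j]) auto
  qed
  then obtain j where j: "j < k" "j \<notin> U \<longleftrightarrow> c (Suc i) < empty_blocks k c i"
    "c (Suc i) = card {l \<in> W. j < l} + (if j \<in> U then j else 0)" by blast
  define g where "g = f(Suc i := j)"
  have img: "g ` {1..<a} = f ` {1..<a}" if "a \<le> Suc i" for a
    unfolding g_def using that by (intro image_cong) auto
  have imgU: "g ` {1..<Suc i} = U" using img[of "Suc i"] by (simp add: U_def atLeastLessThanSuc_atLeastAtMost)
  have "insertion_step k c g a" if a: "a \<in> {1..Suc i}" for a
  proof (cases "a = Suc i")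
    case True
    have "{l \<in> W. j < l} = {l. j < l \<and> l < k \<and> l \<notin> U}" by (auto simp: W_def)
    thus ?thesis using True j imgU by (cases "j \<in> U") (auto simp: insertion_step_def g_def)
  next
    case False
    hence "insertion_step k c f a" using f(1) a by auto
    moreover have "g a = f a" using False by (simp add: g_def)
    moreover have "g ` {1..<a} = f ` {1..<a}" using a by (intro img) auto
    ultimately show ?thesis unfolding insertion_step_def by (simp only:)
  qed
  moreover have "card (g ` {1..Suc i}) + empty_blocks k c (Suc i) = k"
  proof -
    have "{1..Suc i} = insert (Suc i) {1..<Suc i}" by auto
    hence "g ` {1..Suc i} = insert (g (Suc i)) (g ` {1..<Suc i})" by (simp only: image_insert)
    hence "g ` {1..Suc i} = insert j U" unfolding imgU by (simp add: g_def)
    thus ?thesis using j(2) f(2)[folded U_def] finU by (cases "j \<in> U") (simp_all add: insert_absorb)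
  qed
  ultimately show ?case by blast
qed simp

text \<open>The blocks are the fibres of the insertion map. None is empty because
  \<open>empty_blocks\<close> ends at 0.\<close>

lemma greedy_word_is_code:
  assumes c: "greedy_word n k r c" and rn: "r \<le> n"
  shows "\<exists>Bs\<in>ordered_partitions n k r. \<forall>i\<in>{1..n}. coinv_code Bs i = c i"
proof -
  have "\<exists>f. (\<forall>a\<in>{1..n}. insertion_step k c f a) \<and> card (f ` {1..n}) + empty_blocks k c n = k"
    using c by (intro ex_insertion) (auto simp: greedy_word_def)
  then obtain f where f': "\<forall>a\<in>{1..n}. insertion_step k c f a"
    "card (f ` {1..n}) + empty_blocks k c n = k" by blast
  have f: "\<And>a. a \<in> {1..n} \<Longrightarrow> insertion_step k c f a" "card (f ` {1..n}) = k"
    using f' c by (simp_all add: greedy_word_def)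
  have fk: "f a < k" if "a \<in> {1..n}" for a using f(1)[OF that] by (simp add: insertion_step_def)
  have onto: "f ` {1..n} = {..<k}"
    using fk f(2) by (intro card_subset_eq) auto
  define blk where "blk j = {i \<in> {1..n}. f i = j}" for j
  define Bs where "Bs = map blk [0..<k]"
  have len: "length Bs = k" and nth: "\<And>j. j < k \<Longrightarrow> Bs ! j = blk j" by (simp_all add: Bs_def)
  have fin: "finite (blk j)" for j by (simp add: blk_def)
  have ne: "blk j \<noteq> {}" if "j < k" for j
  proof -
    have "j \<in> f ` {1..n}" using that onto by simp
    thus ?thesis by (auto simp: blk_def)
  qed
  have disj: "j = j'" if "i \<in> blk j" "i \<in> blk j'" for i j j' using that by (simp add: blk_def)
  have inj: "inj_on blk {0..<k}"
  proof (rule inj_onI)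
    fix j j' assume "j \<in> {0..<k}" "blk j = blk j'"
    thus "j = j'" using ne[of j] disj by auto
  qed
  \<comment> \<open>At least k - a + 1 blocks are empty before \<open>a\<close>, while its letter is
    at most k - a. So each of 1, ..., r opens a block of its own.\<close>
  have first: "f a \<notin> f ` {1..<a}" if "a \<in> {1..r}" for a
  proof -
    have "a - 1 + empty_blocks k c (a - 1) \<ge> k" using empty_blocks_count[of k c "a - 1"] by simp
    moreover have "c a + a \<le> k" using c that by (simp add: greedy_word_def)
    ultimately have "c a < empty_blocks k c (a - 1)" using that by auto
    thus ?thesis using f(1)[of a] that rn by (simp add: insertion_step_def)
  qed
  have "Bs \<in> ordered_partitions n k r"
    unfolding ordered_partitions_def
  proof (intro CollectI conjI ballI impI)
    show "length Bs = k" by (rule len)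
    show "distinct Bs" using inj by (simp add: Bs_def distinct_map)
    show "partition_on {1..n} (set Bs)"
    proof (rule partition_onI)
      show "\<Union> (set Bs) = {1..n}" using fk by (auto simp: Bs_def blk_def)
      show "{} \<notin> set Bs"
      proof
        assume "{} \<in> set Bs"
        then obtain j where "j < k" "blk j = {}" by (auto simp: Bs_def)
        thus False using ne by blast
      qed
      show "disjnt p q" if "p \<in> set Bs" "q \<in> set Bs" "p \<noteq> q" for p q
        using that by (auto simp: Bs_def blk_def disjnt_def)
    qed
    fix a b B assume ab: "a \<in> {1..r}" "b \<in> {1..r}" "B \<in> set Bs" "a \<in> B" "b \<in> B"
    hence eq: "f a = f b" by (auto simp: Bs_def blk_def)
    show "a = b"
    proof (rule ccontr)
      assume "a \<noteq> b"
      hence "a \<in> {1..<b} \<or> b \<in> {1..<a}" using ab by auto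
      thus False using first[OF ab(1)] first[OF ab(2)] eq by (metis image_eqI)
    qed
  qed
  moreover have "coinv_code Bs i = c i" if i: "i \<in> {1..n}" for i
  proof -
    have idx: "block_index Bs i = f i"
      unfolding block_index_def
      by (rule the_equality) (use i fk[OF i] in \<open>auto simp: len nth blk_def\<close>)
    have Min: "i < Min (Bs ! l) \<longleftrightarrow> l \<notin> f ` {1..i}" if "l < k" for l
    proof -
      have "i < Min (Bs ! l) \<longleftrightarrow> (\<forall>a\<in>blk l. i < a)"
        using nth[OF that] fin[of l] ne[OF that] by simp
      also have "\<dots> \<longleftrightarrow> l \<notin> f ` {1..i}" using i by (fastforce simp: blk_def not_less)
      finally show ?thesis .
    qed
    have isMin: "i = Min (Bs ! f i) \<longleftrightarrow> f i \<notin> f ` {1..<i}"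
    proof -
      have "i \<in> blk (f i)" using i by (simp add: blk_def)
      hence "i = Min (Bs ! f i) \<longleftrightarrow> (\<forall>a\<in>blk (f i). i \<le> a)"
        using nth[OF fk[OF i]] fin[of "f i"] by (metis Min_eqI Min_le)
      also have "\<dots> \<longleftrightarrow> f i \<notin> f ` {1..<i}"
      proof
        assume *: "\<forall>a\<in>blk (f i). i \<le> a"
        show "f i \<notin> f ` {1..<i}"
        proof
          assume "f i \<in> f ` {1..<i}"
          then obtain a where "a \<in> {1..<i}" "f a = f i" by force
          thus False using * i by (force simp: blk_def)
        qed
      next
        assume *: "f i \<notin> f ` {1..<i}"
        show "\<forall>a\<in>blk (f i). i \<le> a"
        proof (rule ballI, rule ccontr)
          fix a assume "a \<in> blk (f i)" "\<not> i \<le> a"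
          hence "a \<in> {1..<i}" "f i = f a" by (auto simp: blk_def)
          thus False using * by blast
        qed
      qed
      finally show ?thesis .
    qed
    \<comment> \<open>The block of \<open>i\<close> itself is excluded by \<open>f i < l\<close>, so
      it makes no difference whether occupation is tested before or after the insertion of
      \<open>i\<close>.\<close>
    have "{l. f i < l \<and> l < length Bs \<and> i < Min (Bs ! l)} = {l. f i < l \<and> l < k \<and> l \<notin> f ` {1..<i}}"
    proof -
      have "{1..i} = insert i {1..<i}" using i by auto
      thus ?thesis using Min by (auto simp: len)
    qed
    moreover have "c i = card {l. f i < l \<and> l < k \<and> l \<notin> f ` {1..<i}} + (if f i \<in> f ` {1..<i} then f i else 0)"
      using f(1)[OF i] unfolding insertion_step_def by blast
    ultimately show ?thesis
      unfolding coinv_code_def idx Let_def isMin by simp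
  qed
  ultimately show ?thesis by blast
qed

lemma lookup_code_sum:
  fixes f :: "nat \<Rightarrow> nat" and n :: nat
  shows
  "Poly_Mapping.lookup (\<Sum>i=1..n. Poly_Mapping.single i (f i)) j = (if j \<in> {1..n} then f j else 0)"
  by (simp only: lookup_sum_single finite_atLeastAtMost when_def)

lemma code_monos_subset: "code_monos n k r \<subseteq> monomials n"
  unfolding code_monos_def by (auto intro!: monomials_sum monomials_single)

lemma greedy_word_in_code_monos:
  assumes "m \<in> monomials n" "greedy_word n k r (Poly_Mapping.lookup m)" "r \<le> n"
  shows "m \<in> code_monos n k r"
proof -
  obtain Bs where Bs: "Bs \<in> ordered_partitions n k r" "\<forall>i\<in>{1..n}. coinv_code Bs i = Poly_Mapping.lookup m i"
    using greedy_word_is_code[OF assms(2,3)] by blast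
  have "m = (\<Sum>i=1..n. Poly_Mapping.single i (coinv_code Bs i))"
  proof (rule poly_mapping_eqI)
    fix j
    show "Poly_Mapping.lookup m j =
        Poly_Mapping.lookup (\<Sum>i=1..n. Poly_Mapping.single i (coinv_code Bs i)) j"
      unfolding lookup_code_sum using Bs(2) lookup_notin_monomials[OF assms(1), of j] by auto
  qed
  thus ?thesis using Bs(1) unfolding code_monos_def by blast
qed


section \<open>Orbit harmonics\<close>

text \<open>The coefficients pass to the target through \<open>h\<close>, the monomials through
  \<open>f\<close>. A multiplicative \<open>f\<close> gives evaluation at a point; cutting it off to
  one degree gives a homogeneous component.\<close>

definition lin_ext :: "('a \<Rightarrow> 'b::comm_ring_1) \<Rightarrow> (mono \<Rightarrow> 'b) \<Rightarrow> 'a::comm_ring_1 mpoly \<Rightarrow> 'b" where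
  "lin_ext h f p = (\<Sum>m\<in>Poly_Mapping.keys p. h (Poly_Mapping.lookup p m) * f m)"

locale coeff_hom =
  fixes h :: "'a::comm_ring_1 \<Rightarrow> 'b::comm_ring_1"
  assumes h_1: "h 1 = 1" and h_add: "h (a + b) = h a + h b" and h_mult: "h (a * b) = h a * h b"
begin

lemma h_0 [simp]: "h 0 = 0"
  using h_add[of 0 0] by simp

lemma lin_ext_superset:
  "finite S \<Longrightarrow> Poly_Mapping.keys p \<subseteq> S \<Longrightarrow> lin_ext h f p = (\<Sum>m\<in>S. h (Poly_Mapping.lookup p m) * f m)"
  unfolding lin_ext_def by (intro sum.mono_neutral_left) (auto simp: in_keys_iff)

lemma lin_ext_0 [simp]: "lin_ext h f 0 = 0"
  by (simp add: lin_ext_def)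

lemma lin_ext_single: "lin_ext h f (Poly_Mapping.single m c) = h c * f m"
  by (simp add: lin_ext_def)

lemma lin_ext_add: "lin_ext h f (p + q) = lin_ext h f p + lin_ext h f q"
proof -
  let ?S = "Poly_Mapping.keys p \<union> Poly_Mapping.keys q"
  have "lin_ext h f (p + q) = (\<Sum>m\<in>?S. h (Poly_Mapping.lookup (p + q) m) * f m)"
    using Poly_Mapping.keys_add[of p q] by (intro lin_ext_superset) auto
  also have "\<dots> = lin_ext h f p + lin_ext h f q"
    by (simp add: lookup_add h_add distrib_right sum.distrib lin_ext_superset[of ?S])
  finally show ?thesis .
qed

lemma lin_ext_diff: "lin_ext h f (p - q) = lin_ext h f p - lin_ext h f q"
  using lin_ext_add[of f "p - q" q] by simp

lemma lin_ext_sum: "lin_ext h f (sum g A) = (\<Sum>x\<in>A. lin_ext h f (g x))"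
  by (induction A rule: infinite_finite_induct) (auto simp: lin_ext_add)

lemma lin_ext_single_times:
  "lin_ext h f (Poly_Mapping.single m c * p) = h c * lin_ext h (\<lambda>m'. f (m + m')) p"
proof -
  have "Poly_Mapping.single m c * p =
      (\<Sum>m'\<in>Poly_Mapping.keys p. Poly_Mapping.single (m + m') (c * Poly_Mapping.lookup p m'))"
    using arg_cong[OF poly_mapping_sum_single[of p], of "(*) (Poly_Mapping.single m c)"]
    unfolding sum_distrib_left mult_single .
  thus ?thesis
    by (simp add: lin_ext_sum lin_ext_single h_mult) (simp add: lin_ext_def sum_distrib_left mult.assoc)
qed

lemma lin_ext_mult_left: "lin_ext h (\<lambda>m. a * f m) p = a * lin_ext h f p"
  by (simp add: lin_ext_def sum_distrib_left mult_ac)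

lemma mpoly_hom_lin_ext:
  assumes "f 0 = 1" "\<And>m m'. f (m + m') = f m * f m'"
  shows "mpoly_hom (lin_ext h f)"
proof
  have "lin_ext h f (Poly_Mapping.single 0 1) = 1" by (simp only: lin_ext_single h_1 assms mult_1)
  thus "lin_ext h f 1 = 1" by simp
  show "lin_ext h f (p + q) = lin_ext h f p + lin_ext h f q" for p q by (rule lin_ext_add)
  show "lin_ext h f (p * q) = lin_ext h f p * lin_ext h f q" for p q
  proof -
    have "p * q = (\<Sum>m\<in>Poly_Mapping.keys p. Poly_Mapping.single m (Poly_Mapping.lookup p m) * q)"
      using arg_cong[OF poly_mapping_sum_single[of p], of "\<lambda>p. p * q"] unfolding sum_distrib_right .
    thus ?thesis
      by (simp add: lin_ext_sum lin_ext_single_times assms(2) lin_ext_mult_left)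
        (simp add: lin_ext_def[of h f p] sum_distrib_left sum_distrib_right mult_ac)
  qed
qed

end

section \<open>Values at points and linear algebra of rational functions on them\<close>

definition monoval :: "(nat \<Rightarrow> nat) \<Rightarrow> mono \<Rightarrow> rat" where
  "monoval x m = (\<Prod>i\<in>Poly_Mapping.keys m. rat_of_nat (x i) ^ Poly_Mapping.lookup m i)"

lemma monoval_superset:
  "finite S \<Longrightarrow> Poly_Mapping.keys m \<subseteq> S \<Longrightarrow> monoval x m = (\<Prod>i\<in>S. rat_of_nat (x i) ^ Poly_Mapping.lookup m i)"
  unfolding monoval_def by (intro prod.mono_neutral_left) (auto simp: in_keys_iff)

lemma monoval_0 [simp]: "monoval x 0 = 1"
  by (simp add: monoval_def)

lemma monoval_single [simp]: "monoval x (Poly_Mapping.single i e) = rat_of_nat (x i) ^ e"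
  by (simp add: monoval_def)

lemma monoval_add: "monoval x (m + m') = monoval x m * monoval x m'"
proof -
  let ?S = "Poly_Mapping.keys m \<union> Poly_Mapping.keys m'"
  have "monoval x (m + m') = (\<Prod>i\<in>?S. rat_of_nat (x i) ^ Poly_Mapping.lookup (m + m') i)"
    using Poly_Mapping.keys_add[of m m'] by (intro monoval_superset) auto
  also have "\<dots> = monoval x m * monoval x m'"
    by (simp add: lookup_add power_add prod.distrib monoval_superset[of ?S])
  finally show ?thesis .
qed

interpretation rat_fun: vector_space "\<lambda>(c :: rat) f x. c * f x"
  by unfold_locales (auto simp: fun_eq_iff algebra_simps)

lemma sum_fun_apply: "sum f A x = (\<Sum>a\<in>A. f a x)"
  by (induction A rule: infinite_finite_induct) auto

text \<open>The indicators of the points are linearly independent: evaluating a vanishing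
  combination at one point isolates one coefficient.\<close>

lemma card_le_card_spanning_set:
  fixes X :: "'x set" and S :: "('x \<Rightarrow> rat) set"
  assumes "finite S" "finite X" and span: "\<And>y. y \<in> X \<Longrightarrow> (\<lambda>x. if x = y then 1 else 0) \<in> rat_fun.span S"
  shows "card X \<le> card S"
proof -
  let ?\<delta> = "\<lambda>y x. if x = y then 1 else 0 :: rat"
  have inj: "inj_on ?\<delta> X" by (rule inj_onI) (metis zero_neq_one)
  have "rat_fun.independent (?\<delta> ` X)"
  proof (rule rat_fun.independent_if_scalars_zero)
    show "finite (?\<delta> ` X)" using assms(2) by simp
    fix f :: "('x \<Rightarrow> rat) \<Rightarrow> rat" and d
    assume 0: "(\<Sum>g\<in>?\<delta> ` X. (\<lambda>x. f g * g x)) = 0" and d: "d \<in> ?\<delta> ` X"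
    then obtain y where y: "y \<in> X" "d = ?\<delta> y" by blast
    have "0 = (\<Sum>g\<in>?\<delta> ` X. (\<lambda>x. f g * g x)) y" using 0 by simp
    also have "\<dots> = (\<Sum>z\<in>X. f (?\<delta> z) * ?\<delta> z y)"
      by (simp add: sum.reindex[OF inj] sum_fun_apply)
    also have "\<dots> = (\<Sum>z\<in>X. if z = y then f d else 0)"
      using y by (intro sum.cong) auto
    also have "\<dots> = f d" using y assms(2) by simp
    finally show "f d = 0" by simp
  qed
  moreover have "?\<delta> ` X \<subseteq> rat_fun.span S" using span by blast
  ultimately have "card (?\<delta> ` X) \<le> card S" using rat_fun.independent_span_bound[OF assms(1)] by blast
  thus ?thesis by (simp add: card_image[OF inj])
qed

lemma span_mult_fun:
  assumes "F \<in> rat_fun.span S" "\<And>s. s \<in> S \<Longrightarrow> (\<lambda>x. g x * s x) \<in> rat_fun.span S'"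
  shows "(\<lambda>x. g x * F x) \<in> rat_fun.span S'"
  using assms(1)
proof (induction rule: rat_fun.span_induct_alt)
  case base
  have "(\<lambda>x. g x * 0 x) = 0" by (simp add: fun_eq_iff)
  thus ?case using rat_fun.span_zero by metis
next
  case (step c s F)
  have "(\<lambda>x. c * (g x * s x)) + (\<lambda>x. g x * F x) \<in> rat_fun.span S'"
    using step assms(2) by (intro rat_fun.span_add rat_fun.span_scale)
  also have "(\<lambda>x. c * (g x * s x)) + (\<lambda>x. g x * F x) = (\<lambda>x. g x * ((\<lambda>x. c * s x) + F) x)"
    by (simp add: fun_eq_iff algebra_simps)
  finally show ?case .
qed


text \<open>The coefficients embed into the rationals by \<open>h\<close>, which is the identity for
  the ideal I and the inclusion of the integers for J. All dimension counts then take place over the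
  rationals.\<close>

locale orbit_harmonics = coeff_hom h for h :: "'a::comm_ring_1 \<Rightarrow> rat" +
  fixes n k r :: nat
  assumes h_eq_0: "h a = 0 \<Longrightarrow> a = 0" and rk: "r \<le> k" and kn: "k \<le> n" and k1: "1 \<le> k"
begin

text \<open>
  Ordered set partitions as functions to block indices; the irrelevant coordinates are pinned to 0
  to make \<open>X\<close> finite.
\<close>

definition X :: "(nat \<Rightarrow> nat) set" where
  "X = {x. x ` {1..n} = {..<k} \<and> inj_on x {1..r} \<and> (\<forall>i. i \<notin> {1..n} \<longrightarrow> x i = 0)}"

definition vec :: "mono \<Rightarrow> (nat \<Rightarrow> nat) \<Rightarrow> rat" where
  "vec m = (\<lambda>x. if x \<in> X then monoval x m else 0)"

abbreviation low :: "nat \<Rightarrow> ((nat \<Rightarrow> nat) \<Rightarrow> rat) set" where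
  "low d \<equiv> rat_fun.span (vec ` {m \<in> monomials n. mdeg m < d})"

abbreviation eval :: "(nat \<Rightarrow> nat) \<Rightarrow> 'a mpoly \<Rightarrow> rat" where
  "eval x \<equiv> lin_ext h (monoval x)"

definition component :: "nat \<Rightarrow> 'a mpoly \<Rightarrow> (nat \<Rightarrow> nat) \<Rightarrow> rat" where
  "component d p = (\<lambda>x. if x \<in> X then lin_ext h (\<lambda>m. if mdeg m = d then monoval x m else 0) p else 0)"

text \<open>Each homogeneous component agrees on \<open>X\<close> with a polynomial of smaller
  degree. For rational coefficients this is the ideal of top degree forms of the polynomials
  vanishing on \<open>X\<close>, the ideal of orbit harmonics.\<close>

definition K :: "'a mpoly set" where
  "K = {p \<in> mpolys n. \<forall>d. component d p \<in> low d}"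

lemma finite_X: "finite X"
proof (rule finite_subset)
  show "X \<subseteq> {x. \<forall>i. (i \<in> {1..n} \<longrightarrow> x i \<in> {..<k}) \<and> (i \<notin> {1..n} \<longrightarrow> x i = 0)}"
    unfolding X_def by blast
  show "finite {x :: nat \<Rightarrow> nat. \<forall>i. (i \<in> {1..n} \<longrightarrow> x i \<in> {..<k}) \<and> (i \<notin> {1..n} \<longrightarrow> x i = 0)}"
    by (intro finite_set_of_finite_funs) auto
qed

lemma component_add: "component d (p + q) = component d p + component d q"
  by (auto simp: component_def lin_ext_add fun_eq_iff)

lemma component_diff: "component d (p - q) = component d p - component d q"
  by (auto simp: component_def lin_ext_diff fun_eq_iff)

lemma component_0 [simp]: "component d 0 = 0"
  by (auto simp: component_def fun_eq_iff)

lemma component_eq: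
  "component d p = (\<Sum>m\<in>{m \<in> Poly_Mapping.keys p. mdeg m = d}. (\<lambda>x. h (Poly_Mapping.lookup p m) * vec m x))"
proof
  fix x
  have "lin_ext h (\<lambda>m. if mdeg m = d then monoval x m else 0) p =
      (\<Sum>m\<in>Poly_Mapping.keys p. if mdeg m = d then h (Poly_Mapping.lookup p m) * monoval x m else 0)"
    unfolding lin_ext_def by (intro sum.cong) auto
  also have "\<dots> = (\<Sum>m\<in>{m \<in> Poly_Mapping.keys p. mdeg m = d}. h (Poly_Mapping.lookup p m) * monoval x m)"
    by (simp add: sum.inter_filter)
  finally show "component d p x = (\<Sum>m\<in>{m \<in> Poly_Mapping.keys p. mdeg m = d}.
      (\<lambda>x. h (Poly_Mapping.lookup p m) * vec m x)) x"
    by (simp add: component_def vec_def sum_fun_apply)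
qed

lemma component_single: "mdeg m = d \<Longrightarrow> component d (Poly_Mapping.single m c) = (\<lambda>x. h c * vec m x)"
  by (auto simp: component_def lin_ext_single vec_def fun_eq_iff)

lemma component_single_times:
  "component d (Poly_Mapping.single m c * p) =
     (if mdeg m \<le> d then (\<lambda>x. h c * monoval x m * component (d - mdeg m) p x) else 0)"
proof
  fix x
  have "lin_ext h (\<lambda>m'. if mdeg (m + m') = d then monoval x (m + m') else 0) p =
      lin_ext h (\<lambda>m'. monoval x m * (if mdeg m \<le> d \<and> mdeg m' = d - mdeg m then monoval x m' else 0)) p"
    by (intro arg_cong[where f = "\<lambda>f. lin_ext h f p"]) (auto simp: fun_eq_iff mdeg_add monoval_add)
  also have "\<dots> = monoval x m * (if mdeg m \<le> d then
      lin_ext h (\<lambda>m'. if mdeg m' = d - mdeg m then monoval x m' else 0) p else 0)"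
    unfolding lin_ext_mult_left by (simp add: lin_ext_def)
  finally show "component d (Poly_Mapping.single m c * p) x =
      (if mdeg m \<le> d then (\<lambda>x. h c * monoval x m * component (d - mdeg m) p x) else 0) x"
    by (simp add: component_def lin_ext_single_times)
qed

section \<open>Ideal properties of \<open>K\<close>\<close>

lemma K_0: "0 \<in> K"
  by (simp add: K_def rat_fun.span_zero)

lemma K_add: "p \<in> K \<Longrightarrow> q \<in> K \<Longrightarrow> p + q \<in> K"
  by (auto simp: K_def component_add intro: rat_fun.span_add)

lemma K_sum: "(\<And>x. x \<in> A \<Longrightarrow> f x \<in> K) \<Longrightarrow> sum f A \<in> K"
  by (induction A rule: infinite_finite_induct) (auto simp: K_0 K_add)

text \<open>Multiplication by a monomial raises the degree of a component and the bound on its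
  substitute by the same amount.\<close>

lemma K_single_times:
  assumes m: "m \<in> monomials n" and p: "p \<in> K"
  shows "Poly_Mapping.single m c * p \<in> K"
proof -
  have "component d (Poly_Mapping.single m c * p) \<in> low d" for d
  proof (cases "mdeg m \<le> d")
    case True
    have "(\<lambda>x. h c * monoval x m * component (d - mdeg m) p x) \<in> low d"
    proof (rule span_mult_fun)
      show "component (d - mdeg m) p \<in> low (d - mdeg m)" using p by (simp add: K_def)
      fix s assume "s \<in> vec ` {m' \<in> monomials n. mdeg m' < d - mdeg m}"
      then obtain m' where m': "m' \<in> monomials n" "mdeg m' < d - mdeg m" "s = vec m'" by blast
      have "(\<lambda>x. h c * vec (m + m') x) \<in> low d"
        using m m' by (intro rat_fun.span_scale rat_fun.span_base) (auto simp: mdeg_add monomials_add)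
      also have "(\<lambda>x. h c * vec (m + m') x) = (\<lambda>x. h c * monoval x m * s x)"
        by (auto simp: m'(3) vec_def monoval_add fun_eq_iff)
      finally show "(\<lambda>x. h c * monoval x m * s x) \<in> low d" .
    qed
    thus ?thesis using True by (simp add: component_single_times)
  qed (simp add: component_single_times rat_fun.span_zero)
  thus ?thesis using m p by (auto simp: K_def)
qed

lemma K_mult:
  assumes "a \<in> mpolys n" "p \<in> K"
  shows "a * p \<in> K"
proof -
  have "a * p = (\<Sum>m\<in>Poly_Mapping.keys a. Poly_Mapping.single m (Poly_Mapping.lookup a m) * p)"
    using arg_cong[OF poly_mapping_sum_single[of a], of "\<lambda>a. a * p"] unfolding sum_distrib_right .
  also have "\<dots> \<in> K" using assms by (intro K_sum K_single_times) (auto simp: mpolys_def)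
  finally show ?thesis .
qed

section \<open>The generators lie in \<open>K\<close>\<close>

lemma eval_hom: "mpoly_hom (eval x)"
  by (rule mpoly_hom_lin_ext) (auto simp: monoval_add)

lemma eval_xvar: "eval x (xvar i) = rat_of_nat (x i)"
  by (simp add: xvar_def mpoly_monom_def lin_ext_single h_1)

lemma component_homogeneous:
  assumes "\<And>m. m \<in> Poly_Mapping.keys p \<Longrightarrow> mdeg m = e"
  shows "component d p = (if d = e then (\<lambda>x. if x \<in> X then eval x p else 0) else 0)"
  using assms by (auto simp: component_def lin_ext_def fun_eq_iff intro!: sum.cong)

lemma homogeneous_in_low:
  assumes p: "p \<in> mpolys n" and hom: "\<And>m. m \<in> Poly_Mapping.keys p \<Longrightarrow> mdeg m = e" and "e < d"
  shows "component e p \<in> low d"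
  unfolding component_eq using assms
  by (intro rat_fun.span_sum rat_fun.span_scale rat_fun.span_base) (auto simp: mpolys_def)

text \<open>
  A relation of this shape says that \<open>g d\<close> agrees on \<open>X\<close> with a polynomial of smaller degree.
\<close>

lemma in_K_of_relation:
  fixes F :: "rat fps"
  assumes g: "\<And>e. g e \<in> mpolys n" "\<And>e m. m \<in> Poly_Mapping.keys (g e) \<Longrightarrow> mdeg m = e"
    and F: "fps_nth F 0 = 1"
    and rel: "\<And>x. x \<in> X \<Longrightarrow> fps_nth (F * Abs_fps (\<lambda>e. eval x (g e))) d = 0"
  shows "g d \<in> K"
proof -
  \<comment> \<open>The coefficient of t^d is solved for its term with i = 0, where F contributes 1.
    The other terms involve g of degree less than d, with factors from F that are the same at all
    points.\<close>
  have "component d (g d) = (\<Sum>i=1..d. (\<lambda>x. - fps_nth F i * component (d - i) (g (d - i)) x))"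
  proof
    fix x
    show "component d (g d) x = (\<Sum>i=1..d. (\<lambda>x. - fps_nth F i * component (d - i) (g (d - i)) x)) x"
    proof (cases "x \<in> X")
      case True
      have "0 = (\<Sum>i=0..d. fps_nth F i * eval x (g (d - i)))"
        using rel[OF True] by (simp add: fps_mult_nth)
      also have "\<dots> = eval x (g d) + (\<Sum>i=1..d. fps_nth F i * eval x (g (d - i)))"
        by (simp add: sum.atLeast_Suc_atMost F)
      finally have "eval x (g d) = (\<Sum>i=1..d. - fps_nth F i * eval x (g (d - i)))"
        by (simp add: sum_negf eq_neg_iff_add_eq_0)
      thus ?thesis using True g(2) by (simp add: component_homogeneous sum_fun_apply)
    qed (simp add: component_def sum_fun_apply)
  qed
  also have "\<dots> \<in> low d"
    using g by (intro rat_fun.span_sum rat_fun.span_scale homogeneous_in_low) auto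
  finally have "component d (g d) \<in> low d" .
  moreover have "component d' (g d) \<in> low d'" if "d' \<noteq> d" for d'
    using that g(2) by (simp add: component_homogeneous[of _ d] rat_fun.span_zero)
  ultimately have "component d' (g d) \<in> low d'" for d' by (cases "d' = d") simp_all
  thus ?thesis using g(1) unfolding K_def by blast
qed

text \<open>Every point of \<open>X\<close> takes exactly the values 0, ..., k-1, so this product is
  common to all points. It or its inverse serves as the series F in
  \<open>in_K_of_relation\<close>.\<close>

definition value_poly :: "rat fps" where
  "value_poly = (\<Prod>j<k. linfac rat_of_nat j)"

lemma prod_linfac_inj:
  assumes "inj_on x A"
  shows "(\<Prod>i\<in>A. linfac (\<lambda>i. rat_of_nat (x i)) i) = (\<Prod>j\<in>x ` A. linfac rat_of_nat j)"
  using assms by (simp add: prod.reindex linfac_def)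

lemma value_poly_0: "fps_nth value_poly 0 = 1"
  unfolding value_poly_def by (rule prod_linfac_nth_0)

text \<open>At a point of \<open>X\<close> each of the k values occurs, so \<open>value_poly\<close>
  divides the product of all 1 - x_i t. The quotient has n - k factors and no coefficient beyond
  that degree.\<close>

lemma esym_in_K:
  assumes "n - k < d"
  shows "esym n d \<in> K"
proof -
  \<comment> \<open>With the sign included, the series is the product of the factors 1 - x_i t
    itself; the sign is removed at the end by a second multiplication.\<close>
  let ?g = "\<lambda>e. (- 1) ^ e * esym n e :: 'a mpoly"
  have "?g d \<in> K"
  proof (rule in_K_of_relation[where F = "inverse value_poly"])
    fix e
    show "?g e \<in> mpolys n" by simp
    fix m assume m: "m \<in> Poly_Mapping.keys (?g e)"
    have prod: "(\<Prod>i\<in>S. xvar i :: 'a mpoly) = mpoly_monom (\<Sum>i\<in>S. Poly_Mapping.single i 1)" for S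
      by (induction S rule: infinite_finite_induct) (auto simp: xvar_def mpoly_monom_def mult_single)
    have deg: "mdeg (\<Sum>i\<in>S. Poly_Mapping.single i 1) = card S" for S
      by (induction S rule: infinite_finite_induct) (auto simp: mdeg_add)
    have "(- 1 :: 'a mpoly) ^ e = Poly_Mapping.single 0 ((- 1) ^ e)"
      by (cases "even e") (auto simp: single_uminus)
    hence "m \<in> Poly_Mapping.keys (esym n e :: 'a mpoly)"
      using m keys_single_times[of 0 "(- 1) ^ e" "esym n e :: 'a mpoly"] by auto
    hence "m \<in> (\<Union>S\<in>{S. S \<subseteq> {1..n} \<and> card S = e}. Poly_Mapping.keys (\<Prod>i\<in>S. xvar i :: 'a mpoly))"
      unfolding esym_def by (rule subsetD[OF keys_sum_subset])
    then obtain S where "card S = e" "m \<in> Poly_Mapping.keys (\<Prod>i\<in>S. xvar i :: 'a mpoly)" by blast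
    thus "mdeg m = e" unfolding prod mpoly_monom_def using deg by auto
  next
    show "fps_nth (inverse value_poly) 0 = 1" by (simp add: value_poly_0)
    fix x assume x: "x \<in> X"
    interpret mpoly_hom "eval x" by (rule eval_hom)
    \<comment> \<open>A choice of one position for each value.\<close>
    obtain A where A: "A \<subseteq> {1..n}" "bij_betw x A {..<k}"
      using x subset_image_inj[of "{..<k}" x "{1..n}"] by (auto simp: X_def bij_betw_def)
    have finA: "finite A" using A(1) finite_subset by blast
    have cardA: "card A = k" using bij_betw_same_card[OF A(2)] by simp
    have neg: "eval x (?g e) = (- 1) ^ e * eval x (esym n e)" for e
    proof (cases "even e")
      case False
      have "eval x (- p) = - eval x p" for p using hom_add[of p "- p"] by (simp add: hom_0 eq_neg_iff_add_eq_0 add.commute)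
      thus ?thesis using False by simp
    qed simp
    have "Abs_fps (\<lambda>e. eval x (?g e)) = (\<Prod>i\<in>{1..n}. linfac (\<lambda>i. rat_of_nat (x i)) i)"
      unfolding neg esym_fps eval_xvar ..
    also have "\<dots> = (\<Prod>i\<in>A. linfac (\<lambda>i. rat_of_nat (x i)) i) * (\<Prod>i\<in>{1..n} - A. linfac (\<lambda>i. rat_of_nat (x i)) i)"
      using A(1) by (simp add: prod.subset_diff mult.commute)
    also have "(\<Prod>i\<in>A. linfac (\<lambda>i. rat_of_nat (x i)) i) = value_poly"
      using A(2) prod_linfac_inj[of x A] by (simp add: bij_betw_def value_poly_def)
    finally have "inverse value_poly * Abs_fps (\<lambda>e. eval x (?g e)) =
        inverse value_poly * value_poly * (\<Prod>i\<in>{1..n} - A. linfac (\<lambda>i. rat_of_nat (x i)) i)"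
      by (simp add: mult.assoc)
    also have "inverse value_poly * value_poly = 1"
      by (rule inverse_mult_eq_1) (simp add: value_poly_0)
    also have "fps_nth (1 * (\<Prod>i\<in>{1..n} - A. linfac (\<lambda>i. rat_of_nat (x i)) i)) d = 0"
      unfolding mult_1 using assms finA cardA A(1)
      by (intro prod_linfac_nth_eq_0) (auto simp: card_Diff_subset)
    finally show "fps_nth (inverse value_poly * Abs_fps (\<lambda>e. eval x (?g e))) d = 0" .
  qed
  hence "(- 1) ^ d * ?g d \<in> K" by (rule K_mult[rotated]) simp
  moreover have "(- 1) ^ d * ?g d = esym n d" by (cases "even d") auto
  ultimately show ?thesis by metis
qed

text \<open>The first r coordinates are distinct, so \<open>value_poly\<close> divided by their
  factors is the product over the k - r values that they miss.\<close>

lemma hsym_in_K: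
  assumes "k - r < d"
  shows "hsym r d \<in> K"
proof (rule in_K_of_relation[where F = value_poly])
  show "hsym r e \<in> mpolys n" for e using rk kn by simp
  show "mdeg m = e" if "m \<in> Poly_Mapping.keys (hsym r e :: 'a mpoly)" for e m
    using that by (simp add: keys_hsym hmonos_def)
  show "fps_nth value_poly 0 = 1" by (rule value_poly_0)
  fix x assume x: "x \<in> X"
  interpret mpoly_hom "eval x" by (rule eval_hom)
  have inj: "inj_on x {1..r}" and sub: "x ` {1..r} \<subseteq> {..<k}" using x rk kn by (auto simp: X_def)
  have card: "card (x ` {1..r}) = r" using inj by (simp add: card_image)
  have "value_poly = (\<Prod>j\<in>{..<k} - x ` {1..r}. linfac rat_of_nat j) * (\<Prod>i=1..r. linfac (\<lambda>i. eval x (xvar i)) i)"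
    unfolding value_poly_def eval_xvar prod_linfac_inj[OF inj] using sub by (simp add: prod.subset_diff)
  hence "value_poly * Abs_fps (\<lambda>e. eval x (hsym r e)) = (\<Prod>j\<in>{..<k} - x ` {1..r}. linfac rat_of_nat j)"
    using hsym_fps[of r] by (simp add: mult.assoc)
  thus "fps_nth (value_poly * Abs_fps (\<lambda>e. eval x (hsym r e))) d = 0"
    using assms sub card by (simp add: prod_linfac_nth_eq_0 card_Diff_subset)
qed

text \<open>The geometric series in x_i t cancels one factor of \<open>value_poly\<close> and leaves
  k - 1 of them.\<close>

lemma power_in_K:
  assumes i: "i \<in> {1..n}"
  shows "xvar i ^ k \<in> K"
proof (rule in_K_of_relation[where F = value_poly])
  show "xvar i ^ e \<in> mpolys n" for e using i by simp
  show "mdeg m = e" if "m \<in> Poly_Mapping.keys (xvar i ^ e :: 'a mpoly)" for e m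
    using that by (simp add: power_xvar mpoly_monom_def)
  show "fps_nth value_poly 0 = 1" by (rule value_poly_0)
  fix x assume x: "x \<in> X"
  have xi: "x i < k" using x i by (auto simp: X_def)
  have "Abs_fps (\<lambda>e. eval x (xvar i ^ e)) = Abs_fps (\<lambda>e. rat_of_nat (x i) ^ e)"
    unfolding power_xvar mpoly_monom_def lin_ext_single by (simp add: h_1)
  moreover have "linfac rat_of_nat (x i) * Abs_fps (\<lambda>e. rat_of_nat (x i) ^ e) = 1"
  proof (rule fps_ext)
    fix d show "fps_nth (linfac rat_of_nat (x i) * Abs_fps (\<lambda>e. rat_of_nat (x i) ^ e)) d = fps_nth 1 d"
      by (cases d) (auto simp: linfac_mult_nth_0 linfac_mult_nth_Suc)
  qed
  moreover have "value_poly = (\<Prod>j\<in>{..<k} - {x i}. linfac rat_of_nat j) * linfac rat_of_nat (x i)"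
    unfolding value_poly_def using xi by (simp add: prod.remove[of _ "x i"] mult.commute)
  ultimately have "value_poly * Abs_fps (\<lambda>e. eval x (xvar i ^ e)) = (\<Prod>j\<in>{..<k} - {x i}. linfac rat_of_nat j)"
    by (simp add: mult.assoc)
  thus "fps_nth (value_poly * Abs_fps (\<lambda>e. eval x (xvar i ^ e))) k = 0"
    using xi k1 by (simp add: prod_linfac_nth_eq_0)
qed

section \<open>From the ideal to functions on the points\<close>

lemma ideal_subset_K: "stirling_ideal n k r \<subseteq> K"
  unfolding stirling_ideal_def
proof (rule genideal_least)
  show "stirling_gens n k r \<subseteq> K"
    using power_in_K esym_in_K hsym_in_K by (auto simp: stirling_gens_def)
  show "K \<subseteq> mpolys n" by (auto simp: K_def)
qed (rule K_0 K_add K_mult; assumption)+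

text \<open>Interpolation: the product of x_i - j over all i and all values j other than y_i is
  nonzero at \<open>y\<close> and vanishes at every other point of \<open>X\<close>. It is then
  rescaled.\<close>

lemma delta_in_span:
  assumes y: "y \<in> X"
  shows "(\<lambda>x. if x = y then 1 else 0) \<in> rat_fun.span (vec ` monomials n)"
proof -
  let ?Q = "rat_fun.span (vec ` monomials n)"
  let ?p = "\<lambda>A x. if x \<in> X then \<Prod>(i, j)\<in>A. rat_of_nat (x i) - rat_of_nat j else 0"
  have Q: "?p A \<in> ?Q" if "finite A" "fst ` A \<subseteq> {1..n}" for A
    using that
  proof (induction A rule: finite_induct)
    case empty
    have "vec 0 \<in> ?Q" by (intro rat_fun.span_base) auto
    moreover have "?p {} = vec 0" by (simp add: vec_def fun_eq_iff)
    ultimately show ?case by metis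
  next
    case (insert a A)
    obtain i j where a: "a = (i, j)" by fastforce
    have i: "i \<in> {1..n}" and pA: "?p A \<in> ?Q" using insert a by auto
    have "(\<lambda>x. rat_of_nat (x i) * ?p A x) \<in> ?Q"
    proof (rule span_mult_fun[OF pA])
      fix s assume "s \<in> vec ` monomials n"
      then obtain m where m: "m \<in> monomials n" "s = vec m" by blast
      have "vec (Poly_Mapping.single i 1 + m) \<in> ?Q"
        using m i by (intro rat_fun.span_base imageI monomials_add monomials_single)
      also have "vec (Poly_Mapping.single i 1 + m) = (\<lambda>x. rat_of_nat (x i) * s x)"
        by (auto simp: m(2) vec_def monoval_add fun_eq_iff)
      finally show "(\<lambda>x. rat_of_nat (x i) * s x) \<in> ?Q" .
    qed
    hence "(\<lambda>x. rat_of_nat (x i) * ?p A x) - (\<lambda>x. rat_of_nat j * ?p A x) \<in> ?Q"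
      by (intro rat_fun.span_diff rat_fun.span_scale pA)
    also have "(\<lambda>x. rat_of_nat (x i) * ?p A x) - (\<lambda>x. rat_of_nat j * ?p A x) = ?p (insert a A)"
      using insert.hyps by (auto simp: a fun_eq_iff left_diff_distrib)
    finally show ?case .
  qed
  define A where "A = (SIGMA i:{1..n}. {..<k} - {y i})"
  have "finite A" "fst ` A \<subseteq> {1..n}" by (auto simp: A_def)
  hence pQ: "?p A \<in> ?Q" by (rule Q)
  have nz: "?p A y \<noteq> 0" using y \<open>finite A\<close> by (auto simp: A_def)
  have z: "?p A x = 0" if "x \<noteq> y" for x
  proof (cases "x \<in> X")
    case True
    obtain i where "x i \<noteq> y i" using \<open>x \<noteq> y\<close> by auto
    moreover hence "i \<in> {1..n}" using True y by (auto simp: X_def)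
    moreover hence "x i < k" using True by (auto simp: X_def)
    ultimately have "(i, x i) \<in> A" by (auto simp: A_def)
    thus ?thesis using \<open>finite A\<close> by (auto intro!: bexI[of _ "(i, x i)"])
  qed simp
  define P where "P = ?p A"
  have P: "P \<in> ?Q" "P y \<noteq> 0" "\<And>x. x \<noteq> y \<Longrightarrow> P x = 0" unfolding P_def by (fact pQ nz z)+
  have "(\<lambda>x. inverse (P y) * P x) \<in> ?Q" by (rule rat_fun.span_scale[OF P(1)])
  also have "(\<lambda>x. inverse (P y) * P x) = (\<lambda>x. if x = y then 1 else 0)"
  proof
    fix x show "inverse (P y) * P x = (if x = y then 1 else 0)" using P(2) P(3)[of x] by simp
  qed
  finally show ?thesis .
qed

text \<open>Spanning modulo the ideal passes to spanning of the functions on \<open>X\<close>. A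
  nonzero relation would express one monomial of \<open>M\<close> on \<open>X\<close> by the others,
  leaving fewer than card X functions that still span all indicators.\<close>

lemma independent_of_spanning:
  assumes M: "M \<subseteq> monomials n" "finite M" "card M \<le> card X"
    and span: "\<And>m. m \<in> monomials n \<Longrightarrow>
      \<exists>p. Poly_Mapping.keys p \<subseteq> M \<and> mpoly_monom m - p \<in> (stirling_ideal n k r :: 'a mpoly set)"
  shows "mono_independent (stirling_ideal n k r :: 'a mpoly set) M"
proof -
  have part: "component d p \<in> rat_fun.span (vec ` S)"
    if "\<And>m. m \<in> Poly_Mapping.keys p \<Longrightarrow> mdeg m = d \<Longrightarrow> m \<in> S" for p d S
    unfolding component_eq using that
    by (intro rat_fun.span_sum rat_fun.span_scale rat_fun.span_base) auto
  \<comment> \<open>Induction on the degree. Modulo the ideal, m is a combination p of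
    \<open>M\<close>; on the points it differs from the degree d component of p by a function of
    lower degree, since the ideal lies in \<open>K\<close>.\<close>
  have vec_M: "vec m \<in> rat_fun.span (vec ` {m \<in> M. mdeg m \<le> d})" if "m \<in> monomials n" "mdeg m = d" for m d
    using that
  proof (induction d arbitrary: m rule: less_induct)
    case (less d)
    obtain p :: "'a mpoly" where p: "Poly_Mapping.keys p \<subseteq> M" "mpoly_monom m - p \<in> stirling_ideal n k r"
      using span[OF less.prems(1)] by blast
    have "component d (mpoly_monom m - p) \<in> low d" using p(2) ideal_subset_K by (auto simp: K_def)
    also have "low d \<subseteq> rat_fun.span (vec ` {m \<in> M. mdeg m \<le> d})"
    proof (rule rat_fun.span_minimal[OF _ rat_fun.subspace_span], rule subsetI)
      fix v assume "v \<in> vec ` {m \<in> monomials n. mdeg m < d}"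
      then obtain m' where m': "m' \<in> monomials n" "mdeg m' < d" "v = vec m'" by blast
      hence "v \<in> rat_fun.span (vec ` {m \<in> M. mdeg m \<le> mdeg m'})" using less.IH by blast
      also have "\<dots> \<subseteq> rat_fun.span (vec ` {m \<in> M. mdeg m \<le> d})"
        using m'(2) by (intro rat_fun.span_mono) auto
      finally show "v \<in> rat_fun.span (vec ` {m \<in> M. mdeg m \<le> d})" .
    qed
    finally have "component d (mpoly_monom m - p) \<in> rat_fun.span (vec ` {m \<in> M. mdeg m \<le> d})" .
    moreover have "component d p \<in> rat_fun.span (vec ` {m \<in> M. mdeg m \<le> d})"
      using p(1) by (intro part) auto
    ultimately have "component d (mpoly_monom m - p) + component d p \<in>
        rat_fun.span (vec ` {m \<in> M. mdeg m \<le> d})" by (rule rat_fun.span_add)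
    also have "component d (mpoly_monom m - p) + component d p = component d (mpoly_monom m)"
      by (simp flip: component_add)
    also have "\<dots> = vec m"
      using less.prems(2) by (simp add: component_single mpoly_monom_def h_1)
    finally show ?case .
  qed
  show ?thesis
    unfolding mono_independent_def
  proof (intro ballI impI, rule ccontr)
    fix p assume p: "p \<in> stirling_ideal n k r" "Poly_Mapping.keys p \<subseteq> M" "p \<noteq> (0 :: 'a mpoly)"
    then obtain m where m: "m \<in> Poly_Mapping.keys p" by (metis all_not_in_conv keys_eq_empty)
    let ?d = "mdeg m" and ?c = "h (Poly_Mapping.lookup p m)"
    let ?Q = "rat_fun.span (vec ` (M - {m}))"
    have c: "?c \<noteq> 0" using m h_eq_0 by (auto simp: in_keys_iff)
    \<comment> \<open>The degree bound in \<open>vec_M\<close> matters here: the representation of a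
      monomial of smaller degree cannot involve m itself.\<close>
    have lower: "vec m' \<in> ?Q" if "m' \<in> monomials n" "mdeg m' < ?d" for m'
    proof -
      have "vec m' \<in> rat_fun.span (vec ` {m \<in> M. mdeg m \<le> mdeg m'})" using vec_M that by blast
      also have "\<dots> \<subseteq> ?Q" using that(2) by (intro rat_fun.span_mono) auto
      finally show ?thesis .
    qed
    have "low ?d \<subseteq> ?Q"
      using lower by (intro rat_fun.span_minimal rat_fun.subspace_span) auto
    hence "component ?d p \<in> ?Q" using p(1) ideal_subset_K by (auto simp: K_def)
    \<comment> \<open>Without its term at m, the degree part of p uses only other monomials of
      \<open>M\<close>. Comparing it with the whole component isolates a nonzero multiple of
      \<open>vec m\<close>.\<close>
    moreover have "component ?d (p - Poly_Mapping.single m (Poly_Mapping.lookup p m)) \<in> ?Q"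
      using p(2) by (intro part) (auto simp: in_keys_iff lookup_minus lookup_single when_def split: if_splits)
    ultimately have "component ?d p - component ?d (p - Poly_Mapping.single m (Poly_Mapping.lookup p m)) \<in> ?Q"
      by (rule rat_fun.span_diff)
    also have "component ?d p - component ?d (p - Poly_Mapping.single m (Poly_Mapping.lookup p m)) =
        component ?d (Poly_Mapping.single m (Poly_Mapping.lookup p m))"
      by (simp add: component_diff)
    also have "\<dots> = (\<lambda>x. ?c * vec m x)"
      by (simp add: component_single)
    finally have "(\<lambda>x. inverse ?c * (?c * vec m x)) \<in> ?Q" by (rule rat_fun.span_scale)
    also have "(\<lambda>x. inverse ?c * (?c * vec m x)) = vec m" using c by (auto simp: fun_eq_iff)
    finally have vm: "vec m \<in> ?Q" .
    have "vec ` M \<subseteq> ?Q"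
    proof
      fix v assume "v \<in> vec ` M"
      then obtain m' where "m' \<in> M" "v = vec m'" by blast
      thus "v \<in> ?Q" using vm by (cases "m' = m") (auto intro: rat_fun.span_base)
    qed
    hence MQ: "rat_fun.span (vec ` M) \<subseteq> ?Q" by (intro rat_fun.span_minimal rat_fun.subspace_span)
    have "vec ` monomials n \<subseteq> ?Q"
    proof
      fix v assume "v \<in> vec ` monomials n"
      then obtain m' where "m' \<in> monomials n" "v = vec m'" by blast
      hence "v \<in> rat_fun.span (vec ` {m \<in> M. mdeg m \<le> mdeg m'})" using vec_M by blast
      also have "\<dots> \<subseteq> rat_fun.span (vec ` M)" by (intro rat_fun.span_mono) auto
      finally show "v \<in> ?Q" using MQ by blast
    qed
    hence "rat_fun.span (vec ` monomials n) \<subseteq> ?Q"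
      by (intro rat_fun.span_minimal rat_fun.subspace_span)
    hence "card X \<le> card (vec ` (M - {m}))"
      using delta_in_span M(2) finite_X by (intro card_le_card_spanning_set) auto
    also have "\<dots> \<le> card (M - {m})" using M(2) by (intro card_image_le) auto
    also have "\<dots> < card M" using M(2) m p(2) by (intro psubset_card_mono) auto
    finally show False using M(3) by simp
  qed
qed

section \<open>Ordered partitions as points\<close>

lemma block_index_eq:
  assumes "partition_on A (set Bs)" "distinct Bs" "j < length Bs" "i \<in> Bs ! j"
  shows "block_index Bs i = j"
  unfolding block_index_def
proof (rule the_equality)
  fix j' assume j': "j' < length Bs \<and> i \<in> Bs ! j'"
  have "Bs ! j' \<in> set Bs" "Bs ! j \<in> set Bs" "i \<in> Bs ! j' \<inter> Bs ! j" using j' assms by auto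
  hence "Bs ! j' = Bs ! j"
    using partition_onD2[OF assms(1)] unfolding disjoint_def by blast
  thus "j' = j" using assms j' by (simp add: nth_eq_iff_index_eq)
qed (use assms in auto)

text \<open>The code monomials are an image of the ordered partitions, and these embed into
  \<open>X\<close>, since the block indices of the letters recover every block.\<close>

lemma card_code_monos: "finite (code_monos n k r)" "card (code_monos n k r) \<le> card X"
proof -
  let ?f = "\<lambda>Bs i. if i \<in> {1..n} then block_index Bs i else 0"
  have Bs_props: "length Bs = k" "distinct Bs" "partition_on {1..n} (set Bs)"
    "\<And>j i. j < k \<Longrightarrow> i \<in> Bs ! j \<Longrightarrow> i \<in> {1..n} \<and> block_index Bs i = j"
    "\<And>i. i \<in> {1..n} \<Longrightarrow> block_index Bs i < k \<and> i \<in> Bs ! block_index Bs i"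
    if Bs: "Bs \<in> ordered_partitions n k r" for Bs
  proof -
    show 1: "length Bs = k" "distinct Bs" "partition_on {1..n} (set Bs)"
      using Bs by (auto simp: ordered_partitions_def)
    show idx: "i \<in> {1..n} \<and> block_index Bs i = j" if "j < k" "i \<in> Bs ! j" for i j
      using block_index_eq[OF 1(3,2), of j i] partition_onD1[OF 1(3)] that 1(1) nth_mem[of j Bs] by auto
    fix i assume "i \<in> {1..n}"
    hence "i \<in> \<Union> (set Bs)" unfolding partition_onD1[OF 1(3), symmetric] .
    then obtain B where "B \<in> set Bs" "i \<in> B" by blast
    then obtain j where "j < k" "i \<in> Bs ! j" using 1(1) by (auto simp: in_set_conv_nth)
    thus "block_index Bs i < k \<and> i \<in> Bs ! block_index Bs i" using idx by auto
  qed
  have "?f Bs \<in> X" if Bs: "Bs \<in> ordered_partitions n k r" for Bs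
  proof -
    have "?f Bs ` {1..n} = {..<k}"
    proof
      show "?f Bs ` {1..n} \<subseteq> {..<k}" using Bs_props(5)[OF Bs] by auto
      show "{..<k} \<subseteq> ?f Bs ` {1..n}"
      proof
        fix j assume j: "j \<in> {..<k}"
        have "Bs ! j \<in> set Bs" using j Bs_props(1)[OF Bs] by (auto intro: nth_mem)
        hence "Bs ! j \<noteq> {}" using partition_onD3[OF Bs_props(3)[OF Bs]] by metis
        then obtain i where "i \<in> Bs ! j" by blast
        thus "j \<in> ?f Bs ` {1..n}" using Bs_props(4)[OF Bs, of j i] j by force
      qed
    qed
    moreover have "inj_on (?f Bs) {1..r}"
    proof (rule inj_onI)
      fix a b assume ab: "a \<in> {1..r}" "b \<in> {1..r}" "?f Bs a = ?f Bs b"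
      hence "block_index Bs a = block_index Bs b" and n: "a \<in> {1..n}" "b \<in> {1..n}" using rk kn by auto
      hence "a \<in> Bs ! block_index Bs a" "b \<in> Bs ! block_index Bs a" "Bs ! block_index Bs a \<in> set Bs"
        using Bs_props(5)[OF Bs, of a] Bs_props(5)[OF Bs, of b] Bs_props(1)[OF Bs] by auto
      moreover have "\<forall>a\<in>{1..r}. \<forall>b\<in>{1..r}. \<forall>B\<in>set Bs. a \<in> B \<longrightarrow> b \<in> B \<longrightarrow> a = b"
        using Bs unfolding ordered_partitions_def by blast
      ultimately show "a = b" using ab(1,2) by blast
    qed
    moreover have "\<forall>i. i \<notin> {1..n} \<longrightarrow> ?f Bs i = 0" by simp
    ultimately show ?thesis unfolding X_def by blast
  qed
  moreover have "inj_on ?f (ordered_partitions n k r)"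
  proof (rule inj_onI)
    fix Bs Cs assume Bs: "Bs \<in> ordered_partitions n k r" and Cs: "Cs \<in> ordered_partitions n k r"
      and eq: "?f Bs = ?f Cs"
    have blocks: "Ds ! j = {i \<in> {1..n}. ?f Ds i = j}"
      if "Ds \<in> ordered_partitions n k r" "j < k" for Ds j
    proof (intro equalityI subsetI)
      fix i assume "i \<in> Ds ! j"
      thus "i \<in> {i \<in> {1..n}. ?f Ds i = j}" using Bs_props(4)[OF that] by auto
    next
      fix i assume "i \<in> {i \<in> {1..n}. ?f Ds i = j}"
      hence "i \<in> {1..n}" "block_index Ds i = j" by auto
      thus "i \<in> Ds ! j" using Bs_props(5)[OF that(1), of i] by blast
    qed
    show "Bs = Cs"
    proof (rule nth_equalityI)
      show "length Bs = length Cs" using Bs_props(1)[OF Bs] Bs_props(1)[OF Cs] by simp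
      fix j assume "j < length Bs"
      hence "j < k" using Bs_props(1)[OF Bs] by simp
      thus "Bs ! j = Cs ! j" by (simp only: blocks[OF Bs] blocks[OF Cs] fun_cong[OF eq])
    qed
  qed
  ultimately have fin: "finite (ordered_partitions n k r)" and le: "card (ordered_partitions n k r) \<le> card X"
    using finite_X by (auto intro: inj_on_finite card_inj_on_le)
  have "code_monos n k r = (\<lambda>Bs. \<Sum>i=1..n. Poly_Mapping.single i (coinv_code Bs i)) ` ordered_partitions n k r"
    by (auto simp: code_monos_def)
  thus "finite (code_monos n k r)" "card (code_monos n k r) \<le> card X"
    using fin le card_image_le[OF fin] by (auto intro: order_trans)
qed

end

section \<open>The code monomials span and are independent\<close>

lemma code_monos_reducible:
  assumes "r \<le> k" "k \<le> n" "1 \<le> k" "m \<in> monomials n" "m \<notin> code_monos n k r"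
  shows "\<exists>g \<in> (stirling_ideal n k r :: 'a::comm_ring_1 mpoly set). monic_at n m g"
  \<comment> \<open>By contraposition: a monomial that is not a code has a non-greedy exponent
    word.\<close>
  using assms greedy_word_in_code_monos[of m n k r]
  by (intro not_greedy_word_reducible) auto

lemma code_monos_spanning:
  assumes "r \<le> k" "k \<le> n" "1 \<le> k" "m \<in> monomials n"
  shows "\<exists>p. Poly_Mapping.keys p \<subseteq> code_monos n k r \<and>
    mpoly_monom m - p \<in> (stirling_ideal n k r :: 'a::comm_ring_1 mpoly set)"
  using monic_at_reduce[OF stirling_ideal_is_ideal[OF assms(1-3)] code_monos_subset
      code_monos_reducible[OF assms(1-3)] assms(4), where 'a = 'a] by blast

lemma (in orbit_harmonics) code_monos_independent:
  "mono_independent (stirling_ideal n k r :: 'a mpoly set) (code_monos n k r)"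
  by (intro independent_of_spanning code_monos_subset card_code_monos code_monos_spanning rk kn k1)

theorem theorem2p3:
  fixes n k r :: nat
  assumes "r \<le> k" and "k \<le> n" and "1 \<le> k"
  shows "(code_monos n k r = standard_monos n (neglex n) (ideal_I n k r) \<and>
          descends_to_basis n (ideal_I n k r) (code_monos n k r)) \<and>
         descends_to_basis n (ideal_J n k r) (code_monos n k r)"
proof -
  interpret Q: orbit_harmonics "\<lambda>a :: rat. a" n k r
  proof (rule orbit_harmonics.intro)
    show "coeff_hom (\<lambda>a :: rat. a)" by (rule coeff_hom.intro) (rule refl)+
    show "orbit_harmonics_axioms (\<lambda>a :: rat. a) n k r"
      by (rule orbit_harmonics_axioms.intro) (assumption | rule assms)+
  qed
  \<comment> \<open>Independence over the integers is tested by rational functions on the same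
    points; spanning over the integers holds because all reductions use monic polynomials.\<close>
  interpret Z: orbit_harmonics rat_of_int n k r
  proof (rule orbit_harmonics.intro)
    show "coeff_hom rat_of_int" by (rule coeff_hom.intro) simp_all
    show "orbit_harmonics_axioms rat_of_int n k r"
    proof (rule orbit_harmonics_axioms.intro)
      show "a = 0" if "rat_of_int a = 0" for a using that by (rule of_int_eq_0_iff[THEN iffD1])
    qed (rule assms)+
  qed
  note basis = descends_to_basisI[OF stirling_ideal_is_ideal[OF assms] code_monos_subset code_monos_spanning[OF assms]]
  have "standard_monos n (neglex n) (ideal_I n k r) = code_monos n k r"
    using code_monos_reducible[OF assms]
    by (intro standard_monos_eqI stirling_ideal_is_ideal assms code_monos_subset Q.code_monos_independent)
  thus ?thesis
    using basis[OF _ Q.code_monos_independent] basis[OF _ Z.code_monos_independent] by simp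
qed

end
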